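(* Let $d\ge2$, $k\ge1$, and let $$f=\sum_{\deg(\theta^a)\le k}c_a\theta^a$$ be a polynomial in $\theta_1,\ldots,\theta_{d-1}$, the sum running over all monomials of degree at most $k$, with scaling vector $c=(c_a)$ having all entries in $\mathbb{C}^*$. Let $\mathcal{C}$ be the symmetric tensor corresponding to $f$. If the tensor rank of $\mathcal{C}$ is equal to one, then $\mathrm{mldeg}(\mathrm{Ver}(d-1,k)^c)=1$.
   Context: Symmetric tensor: the polynomial $f$, having terms of degree $\le k$ in $\theta_1,\ldots,\theta_{d-1}$, corresponds uniquely to a symmetric tensor $\mathcal{C}$ of size $d\times d\times\cdots\times d$ ($k$-fold), namely the one for which $f$ is obtained by contracting $\mathcal{C}$ with $k$ copies of the vector $(1,\theta_1,\ldots,\theta_{d-1})$. $\mathcal{C}$ is said to have tensor rank one if $f$ is a power of a linear form, i.e. $f=L^k$ with $L=b_0+b_1\theta_1+\cdots+b_{d-1}\theta_{d-1}$, $b_i\in\mathbb{C}$. Scaled Veronese: $A$ is the $(d-1)\times n$ integer matrix whose columns $a$ are all the non-negative integer vectors in $\mathbb{Z}^{d-1}$ with coordinate sum $\le k$. $\mathrm{Ver}(d-1,k)^c\subset\mathbb{P}^{n-1}$ is the projective variety over $\mathbb{C}$ whose affine cone is the Zariski closure in $\mathbb{C}^n$ of the image of $(\mathbb{C}^* )^d\to(\mathbb{C}^* )^n$, $(s,\theta_1,\ldots,\theta_{d-1})\mapsto(c_a\,s\,\theta^a)_a$. ML degree: for a projective variety $X\subset\mathbb{P}^{n-1}$ with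 homogeneous coordinates $[p_1:\cdots:p_n]$ and a vector $u=(u_1,\ldots,u_n)$, let $\ell_u(p)=p_1^{u_1}\cdots p_n^{u_n}/(p_1+\cdots+p_n)^{u_1+\cdots+u_n}$. Let $X_{\mathrm{reg}}$ be the set of smooth points of $X$ and let $\mathcal{H}$ be the union of the coordinate hyperplanes and the hyperplane $p_1+\cdots+p_n=0$. Then $\mathrm{mldeg}(X)$ is the number of complex critical points of $\ell_u$ on $X_{\mathrm{reg}}\setminus\mathcal{H}$ for generic $u$ (this number is well-defined). *)

theory Defs
  imports
    "HOL-Analysis.Analysis"
    "HOL-Library.Function_Algebras"
    "HOL-Library.Extended_Nat"
    "HOL-Library.Multiset"
begin

text \<open>
  For a finite index set \<open>I\<close>, points of \<open>\<complex>\<^sup>I\<close> are functions vanishing outside \<open>I\<close>, so that they form a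
  complex vector space under pointwise addition and \<open>cscale\<close>.
\<close>

definition affine_space :: "'i set \<Rightarrow> ('i \<Rightarrow> complex) set" where
  "affine_space I = {p. \<forall>i. i \<notin> I \<longrightarrow> p i = 0}"

definition cscale :: "complex \<Rightarrow> ('i \<Rightarrow> complex) \<Rightarrow> ('i \<Rightarrow> complex)" where
  "cscale t v = (\<lambda>i. t * v i)"

global_interpretation cfun: vector_space "cscale :: complex \<Rightarrow> ('i \<Rightarrow> complex) \<Rightarrow> _"
  by unfold_locales (auto simp: cscale_def fun_eq_iff algebra_simps)

text \<open>
  Polynomials in the coordinates indexed by \<open>I\<close>, identified with the functions
  they induce (\<open>\<complex>\<close> is infinite).
\<close>

definition poly_funs :: "'i set \<Rightarrow> (('i \<Rightarrow> complex) \<Rightarrow> complex) set" where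
  "poly_funs I =
     {F. \<exists>(M :: ('i \<Rightarrow> nat) set) r. finite M \<and> F = (\<lambda>p. \<Sum>m\<in>M. r m * (\<Prod>i\<in>I. p i ^ m i))}"

definition zariski_closed :: "'i set \<Rightarrow> ('i \<Rightarrow> complex) set \<Rightarrow> bool" where
  "zariski_closed I Z \<longleftrightarrow>
     (\<exists>S \<subseteq> poly_funs I. Z = {p \<in> affine_space I. \<forall>F\<in>S. F p = 0})"

definition zariski_closure :: "'i set \<Rightarrow> ('i \<Rightarrow> complex) set \<Rightarrow> ('i \<Rightarrow> complex) set" where
  "zariski_closure I Y = zariski_closed I hull Y"

definition vanishing_ideal ::
    "'i set \<Rightarrow> ('i \<Rightarrow> complex) set \<Rightarrow> (('i \<Rightarrow> complex) \<Rightarrow> complex) set" where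
  "vanishing_ideal I Y = {F \<in> poly_funs I. \<forall>p\<in>Y. F p = 0}"

definition generically :: "'i set \<Rightarrow> (('i \<Rightarrow> complex) \<Rightarrow> bool) \<Rightarrow> bool" where
  "generically I P \<longleftrightarrow>
     (\<exists>Z. zariski_closed I Z \<and> Z \<noteq> affine_space I \<and> (\<forall>u \<in> affine_space I - Z. P u))"

text \<open>
  The point with homogeneous coordinates \<open>p \<noteq> 0\<close> is the set of all its
  representatives; a subset of projective space is a set of such points.
\<close>

definition proj_point :: "('i \<Rightarrow> complex) \<Rightarrow> ('i \<Rightarrow> complex) set" where
  "proj_point p = {cscale t p | t. t \<noteq> 0}"

definition proj_space :: "'i set \<Rightarrow> ('i \<Rightarrow> complex) set set" where
  "proj_space I = proj_point ` (affine_space I - {0})"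

definition affine_cone :: "('i \<Rightarrow> complex) set set \<Rightarrow> ('i \<Rightarrow> complex) set" where
  "affine_cone X = insert 0 (\<Union>X)"

definition proj_closed :: "'i set \<Rightarrow> ('i \<Rightarrow> complex) set set \<Rightarrow> bool" where
  "proj_closed I X \<longleftrightarrow> X \<subseteq> proj_space I \<and> zariski_closed I (affine_cone X)"

definition proj_irreducible :: "'i set \<Rightarrow> ('i \<Rightarrow> complex) set set \<Rightarrow> bool" where
  "proj_irreducible I Z \<longleftrightarrow> proj_closed I Z \<and> Z \<noteq> {} \<and>
     (\<forall>Z1 Z2. proj_closed I Z1 \<and> proj_closed I Z2 \<and> Z = Z1 \<union> Z2 \<longrightarrow> Z = Z1 \<or> Z = Z2)"

text \<open>
  Dimension of \<open>X\<close> at the point \<open>x\<close> (the Krull dimension of the local ring):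
  supremum of the lengths of chains of irreducible closed subsets of \<open>X\<close> through \<open>x\<close>.
\<close>

definition proj_local_dim ::
    "'i set \<Rightarrow> ('i \<Rightarrow> complex) set set \<Rightarrow> ('i \<Rightarrow> complex) set \<Rightarrow> enat" where
  "proj_local_dim I X x =
     Sup {enat m | m. \<exists>Z :: nat \<Rightarrow> ('i \<Rightarrow> complex) set set.
            x \<in> Z 0 \<and> (\<forall>j\<le>m. proj_irreducible I (Z j) \<and> Z j \<subseteq> X) \<and>
            (\<forall>j<m. Z j \<subset> Z (Suc j))}"

text \<open>
  Zariski tangent space at \<open>p\<close> of the affine cone over \<open>X\<close>, i.e. the kernel of the
  Jacobian of the ideal of \<open>X\<close>: the derivative below is the differential of
  \<open>F\<close> at \<open>p\<close> applied to \<open>v\<close>.  For \<open>p \<noteq> 0\<close> on the cone its dimension is one more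
  than that of the tangent space of \<open>X\<close> at \<open>proj_point p\<close>.
\<close>

definition cone_tangent_space ::
    "'i set \<Rightarrow> ('i \<Rightarrow> complex) set set \<Rightarrow> ('i \<Rightarrow> complex) \<Rightarrow> ('i \<Rightarrow> complex) set" where
  "cone_tangent_space I X p =
     {v \<in> affine_space I. \<forall>F \<in> vanishing_ideal I (affine_cone X).
        ((\<lambda>t. F (p + cscale t v)) has_field_derivative 0) (at 0)}"

definition smooth_points :: "'i set \<Rightarrow> ('i \<Rightarrow> complex) set set \<Rightarrow> ('i \<Rightarrow> complex) set set" where
  "smooth_points I X =
     {x \<in> X. \<forall>p\<in>x. enat (cfun.dim (cone_tangent_space I X p)) = proj_local_dim I X x + 1}"

definition likelihood_hyperplanes :: "'i set \<Rightarrow> ('i \<Rightarrow> complex) set set" where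
  "likelihood_hyperplanes I =
     {x \<in> proj_space I. \<exists>p\<in>x. (\<exists>i\<in>I. p i = 0) \<or> (\<Sum>i\<in>I. p i) = 0}"

text \<open>
  For complex exponents \<open>u\<close> the likelihood function
  \<open>\<Prod>\<^sub>i q\<^sub>i\<^bsup>u\<^sub>i\<^esup> / (\<Sum>\<^sub>i q\<^sub>i)\<^bsup>\<Sum>\<^sub>i u\<^sub>i\<^esup>\<close> is multivalued.  Near a point \<open>p\<close> off the
  hyperplanes, its branches are the nonzero constant multiples of the following
  function of \<open>q\<close>, which is holomorphic there because the principal branch of
  \<open>powr\<close> is only used near \<open>1\<close>.
\<close>

definition likelihood_branch ::
    "'i set \<Rightarrow> ('i \<Rightarrow> complex) \<Rightarrow> ('i \<Rightarrow> complex) \<Rightarrow> ('i \<Rightarrow> complex) \<Rightarrow> complex" where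
  "likelihood_branch I u p q =
     (\<Prod>i\<in>I. (q i / p i) powr u i) / ((\<Sum>i\<in>I. q i) / (\<Sum>i\<in>I. p i)) powr (\<Sum>i\<in>I. u i)"

definition likelihood_critical_points ::
    "'i set \<Rightarrow> ('i \<Rightarrow> complex) set set \<Rightarrow> ('i \<Rightarrow> complex) \<Rightarrow> ('i \<Rightarrow> complex) set set" where
  "likelihood_critical_points I X u =
     {x \<in> smooth_points I X - likelihood_hyperplanes I.
        \<forall>p\<in>x. \<forall>v \<in> cone_tangent_space I X p.
          ((\<lambda>t. likelihood_branch I u p (p + cscale t v)) has_field_derivative 0) (at 0)}"

definition mldeg :: "'i set \<Rightarrow> ('i \<Rightarrow> complex) set set \<Rightarrow> nat" where
  "mldeg I X =
     (THE m. generically I (\<lambda>u. finite (likelihood_critical_points I X u) \<and>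
                                card (likelihood_critical_points I X u) = m))"

text \<open>
  Monomials \<open>\<theta>\<^sup>a\<close> in \<open>\<theta>\<^sub>1, \<dots>, \<theta>\<^sub>d\<^sub>-\<^sub>1\<close> are given by exponent functions \<open>a\<close>
  supported on \<open>{1..<d}\<close>.
\<close>

definition veronese_exponents :: "nat \<Rightarrow> nat \<Rightarrow> (nat \<Rightarrow> nat) set" where
  "veronese_exponents d k = {a. (\<forall>i. i \<notin> {1..<d} \<longrightarrow> a i = 0) \<and> (\<Sum>i=1..<d. a i) \<le> k}"

definition theta_monomial :: "nat \<Rightarrow> (nat \<Rightarrow> complex) \<Rightarrow> (nat \<Rightarrow> nat) \<Rightarrow> complex" where
  "theta_monomial d \<theta> a = (\<Prod>i=1..<d. \<theta> i ^ a i)"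

definition scaled_veronese_torus ::
    "nat \<Rightarrow> nat \<Rightarrow> ((nat \<Rightarrow> nat) \<Rightarrow> complex) \<Rightarrow> ((nat \<Rightarrow> nat) \<Rightarrow> complex) set" where
  "scaled_veronese_torus d k c =
     {(\<lambda>a. if a \<in> veronese_exponents d k then c a * s * theta_monomial d \<theta> a else 0) | s \<theta>.
        s \<noteq> 0 \<and> (\<forall>i\<in>{1..<d}. \<theta> i \<noteq> 0)}"

definition scaled_veronese ::
    "nat \<Rightarrow> nat \<Rightarrow> ((nat \<Rightarrow> nat) \<Rightarrow> complex) \<Rightarrow> ((nat \<Rightarrow> nat) \<Rightarrow> complex) set set" where
  "scaled_veronese d k c =
     proj_point ` (zariski_closure (veronese_exponents d k) (scaled_veronese_torus d k c) - {0})"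

definition scaling_poly ::
    "nat \<Rightarrow> nat \<Rightarrow> ((nat \<Rightarrow> nat) \<Rightarrow> complex) \<Rightarrow> (nat \<Rightarrow> complex) \<Rightarrow> complex" where
  "scaling_poly d k c \<theta> = (\<Sum>a\<in>veronese_exponents d k. c a * theta_monomial d \<theta> a)"

text \<open>
  A \<open>k\<close>-fold \<open>d \<times> \<dots> \<times> d\<close> tensor is a function on lists of \<open>k\<close> indices below \<open>d\<close>;
  its values on other lists are irrelevant.
\<close>

definition tensor_indices :: "nat \<Rightarrow> nat \<Rightarrow> nat list set" where
  "tensor_indices d k = {js. length js = k \<and> set js \<subseteq> {..<d}}"

definition symmetric_tensor :: "nat \<Rightarrow> nat \<Rightarrow> (nat list \<Rightarrow> complex) \<Rightarrow> bool" where
  "symmetric_tensor d k T \<longleftrightarrow>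
     (\<forall>js\<in>tensor_indices d k. \<forall>js'\<in>tensor_indices d k. mset js = mset js' \<longrightarrow> T js = T js')"

definition tensor_contraction ::
    "nat \<Rightarrow> nat \<Rightarrow> (nat list \<Rightarrow> complex) \<Rightarrow> (nat \<Rightarrow> complex) \<Rightarrow> complex" where
  "tensor_contraction d k T x = (\<Sum>js\<in>tensor_indices d k. T js * (\<Prod>r<k. x (js ! r)))"

definition tensor_poly ::
    "nat \<Rightarrow> nat \<Rightarrow> (nat list \<Rightarrow> complex) \<Rightarrow> (nat \<Rightarrow> complex) \<Rightarrow> complex" where
  "tensor_poly d k T \<theta> = tensor_contraction d k T (\<lambda>i. if i = 0 then 1 else \<theta> i)"

definition tensor_rank_one :: "nat \<Rightarrow> nat \<Rightarrow> (nat list \<Rightarrow> complex) \<Rightarrow> bool" where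
  "tensor_rank_one d k T \<longleftrightarrow>
     (\<exists>b. \<forall>\<theta>. tensor_poly d k T \<theta> = (b 0 + (\<Sum>i=1..<d. b i * \<theta> i)) ^ k)"

end

theory Submission
  imports Defs
begin

text \<open>
  The cone over the scaled Veronese variety is the closure of the image of the torus under
  \<open>y \<mapsto> (c\<^sub>a y\<^sub>0 y\<^sup>a)\<^sub>a\<close>, and by the binomial relations its points with nonzero coordinates are exactly
  this image. There the tangent space consists of the vectors \<open>(p\<^sub>a (\<sigma> + \<Sum>\<^sub>i a\<^sub>i \<tau>\<^sub>i))\<^sub>a\<close>, and the local
  dimension is \<open>d - 1\<close>: closures of subtori give a chain, and a longer chain would yield more than \<open>d\<close>
  algebraically independent polynomials in \<open>d\<close> variables. So all these points are smooth.
  If \<open>f = L\<^sup>k\<close> with \<open>L = b\<^sub>0 + \<Sum>\<^sub>i b\<^sub>i \<theta>\<^sub>i\<close>, then \<open>\<Sum>\<^sub>a p\<^sub>a = y\<^sub>0 L\<^sup>k\<close> and Euler's operators turn the likelihood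
  equations into \<open>(\<Sum>\<^sub>a u\<^sub>a a\<^sub>i) L = k u\<^sub>+ b\<^sub>i \<theta>\<^sub>i\<close> with \<open>u\<^sub>+ = \<Sum>\<^sub>a u\<^sub>a\<close>, a linear system with one solution for generic \<open>u\<close>.
\<close>

subsection \<open>Polynomial functions\<close>

text \<open>Generators of the ideal of the variety are never determined. Every function in the ideal
  vanishes along curves in the torus, which bounds tangent spaces from below; the binomials alone
  bound them from above, because at a point without zero coordinates their logarithmic derivatives
  already force \<open>v a / p a\<close> to be affine in \<open>a\<close>. Smoothness refers to
  arbitrary chains of closed sets, so the upper bound on the dimension cannot rely on the shape of
  their members. Consecutive members, starting with the vertex of the cone, are separated by
  polynomial functions, and a count of monomials limits how many independent ones exist.
  Irreducibility and genericity both reduce to one variable: two witnesses are joined by a line, and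
  finitely many nonzero polynomials on it are all nonzero at some common point. Rank one enters
  twice. The factor \<open>L ^ (k - 1)\<close> of the Euler derivatives cancels against the
  coordinate sum, which leaves linear equations. And since no \<open>c a\<close> is zero, neither
  are \<open>b 0\<close> and the \<open>b i\<close>, so the solution of these equations lies in the
  torus.\<close>

lemma poly_funs_sumI:
  fixes I :: "'i set" and g :: "'j \<Rightarrow> 'i \<Rightarrow> nat"
  assumes "finite J"
  shows "(\<lambda>p. \<Sum>j\<in>J. r j * (\<Prod>i\<in>I. p i ^ g j i)) \<in> poly_funs I"
proof -
  \<comment> \<open>\<open>poly_funs\<close> is indexed by a set of exponents, so the coefficients
    of all \<open>j\<close> with the same exponent \<open>g j\<close> are merged.\<close>
  have "(\<Sum>j\<in>J. r j * (\<Prod>i\<in>I. p i ^ g j i)) =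
      (\<Sum>m\<in>g ` J. (\<Sum>j\<in>{j\<in>J. g j = m}. r j) * (\<Prod>i\<in>I. p i ^ m i))" for p :: "'i \<Rightarrow> complex"
    by (subst sum.image_gen[OF assms, of _ g]) (auto simp: sum_distrib_right intro!: sum.cong)
  then show ?thesis
    using assms by (auto simp: poly_funs_def intro!: exI[of _ "g ` J"] exI[of _ "\<lambda>m. \<Sum>j\<in>{j\<in>J. g j = m}. r j"])
qed

lemma poly_funsE:
  assumes "F \<in> poly_funs I"
  obtains M r where "finite M" "F = (\<lambda>p. \<Sum>m\<in>M. r m * (\<Prod>i\<in>I. p i ^ m i))"
  using assms by (auto simp: poly_funs_def)

lemma poly_funs_const [intro]: "(\<lambda>p. c) \<in> poly_funs I"
  using poly_funs_sumI[of "{()}", where r = "\<lambda>_. c" and g = "\<lambda>_ _. 0" and I = I] by simp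

lemma poly_funs_coord:
  assumes "finite I" "i \<in> I"
  shows "(\<lambda>p. p i) \<in> poly_funs I"
proof -
  have "(\<Prod>j\<in>I. p j ^ (if j = i then 1 else 0)) = p i" for p :: "'a \<Rightarrow> complex"
    using assms by (simp add: if_distrib[of "(^) _"] cong: if_cong)
  then show ?thesis
    using poly_funs_sumI[of "{()}", where r = "\<lambda>_. 1" and g = "\<lambda>_ j. if j = i then 1 else 0" and I = I] by simp
qed

lemma poly_funs_add:
  assumes "F \<in> poly_funs I" "G \<in> poly_funs I"
  shows "(\<lambda>p. F p + G p) \<in> poly_funs I"
proof -
  obtain M r where M: "finite M" "F = (\<lambda>p. \<Sum>m\<in>M. r m * (\<Prod>i\<in>I. p i ^ m i))"
    using assms(1) by (rule poly_funsE)
  obtain N s where N: "finite N" "G = (\<lambda>p. \<Sum>m\<in>N. s m * (\<Prod>i\<in>I. p i ^ m i))"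
    using assms(2) by (rule poly_funsE)
  have "(\<lambda>p. F p + G p) =
     (\<lambda>p. \<Sum>j\<in>M <+> N. (case j of Inl m \<Rightarrow> r m | Inr m \<Rightarrow> s m) *
            (\<Prod>i\<in>I. p i ^ (case j of Inl m \<Rightarrow> m | Inr m \<Rightarrow> m) i))"
    using M N by (simp add: sum.Plus fun_eq_iff)
  also have "\<dots> \<in> poly_funs I"
    by (rule poly_funs_sumI) (use M N in auto)
  finally show ?thesis .
qed

lemma poly_funs_mult:
  assumes "F \<in> poly_funs I" "G \<in> poly_funs I"
  shows "(\<lambda>p. F p * G p) \<in> poly_funs I"
proof -
  obtain M r where M: "finite M" "F = (\<lambda>p. \<Sum>m\<in>M. r m * (\<Prod>i\<in>I. p i ^ m i))"
    using assms(1) by (rule poly_funsE)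
  obtain N s where N: "finite N" "G = (\<lambda>p. \<Sum>m\<in>N. s m * (\<Prod>i\<in>I. p i ^ m i))"
    using assms(2) by (rule poly_funsE)
  have "(\<lambda>p. F p * G p) =
     (\<lambda>p. \<Sum>j\<in>M \<times> N. (r (fst j) * s (snd j)) * (\<Prod>i\<in>I. p i ^ (fst j i + snd j i)))"
    by (simp add: M N sum_product sum.cartesian_product power_add prod.distrib fun_eq_iff
        case_prod_unfold mult_ac)
  also have "\<dots> \<in> poly_funs I"
    by (rule poly_funs_sumI) (use M N in auto)
  finally show ?thesis .
qed

lemma poly_funs_cmult: "F \<in> poly_funs I \<Longrightarrow> (\<lambda>p. c * F p) \<in> poly_funs I"
  by (rule poly_funs_mult[OF poly_funs_const])

lemma poly_funs_diff:
  assumes "F \<in> poly_funs I" "G \<in> poly_funs I"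
  shows "(\<lambda>p. F p - G p) \<in> poly_funs I"
  using poly_funs_add[OF assms(1) poly_funs_cmult[OF assms(2), of "-1"]] by simp

lemma poly_funs_sum:
  assumes "\<And>j. j \<in> J \<Longrightarrow> F j \<in> poly_funs I"
  shows "(\<lambda>p. \<Sum>j\<in>J. F j p) \<in> poly_funs I"
  using assms by (induction J rule: infinite_finite_induct) (auto intro: poly_funs_add)

lemma poly_funs_prod:
  assumes "\<And>j. j \<in> J \<Longrightarrow> F j \<in> poly_funs I"
  shows "(\<lambda>p. \<Prod>j\<in>J. F j p) \<in> poly_funs I"
  using assms by (induction J rule: infinite_finite_induct) (auto intro: poly_funs_mult)

lemma poly_funs_power:
  assumes "F \<in> poly_funs I"
  shows "(\<lambda>p. F p ^ n) \<in> poly_funs I"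
  using assms by (induction n) (auto intro: poly_funs_mult)

text \<open>Lets composition, restriction to curves, derivatives and degree bounds be treated
  structurally, without handling exponents.\<close>

lemma poly_funs_induct [consumes 1, case_names const coord add mult]:
  assumes "F \<in> poly_funs I"
    and const: "\<And>c. P (\<lambda>p. c)"
    and coord: "\<And>i. i \<in> I \<Longrightarrow> P (\<lambda>p. p i)"
    and add: "\<And>F G. P F \<Longrightarrow> P G \<Longrightarrow> P (\<lambda>p. F p + G p)"
    and mult: "\<And>F G. P F \<Longrightarrow> P G \<Longrightarrow> P (\<lambda>p. F p * G p)"
  shows "P F"
proof -
  obtain M r where M: "finite M" "F = (\<lambda>p. \<Sum>m\<in>M. r m * (\<Prod>i\<in>I. p i ^ m i))"
    using assms(1) by (rule poly_funsE)
  have power: "P (\<lambda>p. p i ^ n)" if "i \<in> I" for i n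
    by (induction n) (use const mult[OF coord[OF that]] in auto)
  have prod: "P (\<lambda>p. \<Prod>i\<in>J. p i ^ m i)" if "J \<subseteq> I" for J m
    using that by (induction J rule: infinite_finite_induct) (auto intro: const mult power)
  have "P (\<lambda>p. \<Sum>m\<in>M. r m * (\<Prod>i\<in>I. p i ^ m i))"
    using M(1) by (induction M) (auto intro!: const add mult prod)
  then show ?thesis
    by (simp add: M)
qed

lemma poly_funs_compose:
  assumes "F \<in> poly_funs I" "\<And>i. i \<in> I \<Longrightarrow> (\<lambda>y. \<phi> y i) \<in> poly_funs J"
  shows "(\<lambda>y. F (\<phi> y)) \<in> poly_funs J"
  using assms(1)
  by (induction rule: poly_funs_induct) (auto intro: poly_funs_add poly_funs_mult assms(2))

lemma poly_funs_cscale: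
  assumes "finite I" "F \<in> poly_funs I"
  shows "(\<lambda>p. F (cscale t p)) \<in> poly_funs I"
  by (rule poly_funs_compose[OF assms(2)])
     (simp add: cscale_def poly_funs_cmult poly_funs_coord[OF assms(1)])

text \<open>The reduction to one variable, where a product vanishes identically only if a factor
  does and a nonzero polynomial has a point where it does not vanish.\<close>

lemma poly_funs_along_curve:
  assumes "F \<in> poly_funs I"
  shows "\<exists>q. \<forall>t. F (\<lambda>i. poly (g i) t) = poly q t"
  using assms
proof (induction rule: poly_funs_induct)
    case (const c)
    show ?case by (rule exI[of _ "[:c:]"]) simp
  next
    case (add F G)
    then show ?case by (metis poly_add)
  next
    case (mult F G)
    then show ?case by (metis poly_mult)
qed auto

text \<open>A chain rule without partial derivatives. The order of quantifiers is the point: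
  \<open>D\<close> depends only on the position \<open>p\<close> and the velocity \<open>v\<close>,
  so a curve and a straight line with the same velocity can be exchanged.\<close>

lemma poly_funs_has_derivative:
  assumes "F \<in> poly_funs I"
  shows "\<exists>D. \<forall>\<gamma>. \<gamma> 0 = p \<longrightarrow> (\<forall>i\<in>I. ((\<lambda>t. \<gamma> t i) has_field_derivative v i) (at 0))
     \<longrightarrow> ((\<lambda>t. F (\<gamma> t)) has_field_derivative D) (at 0)" (is "\<exists>D. ?diff F D")
  using assms
proof (induction rule: poly_funs_induct)
  case (const c)
  show ?case by (rule exI[of _ 0]) simp
next
  case (add F G)
  obtain D where D: "?diff F D" using add(1) by (rule exE)
  obtain E where E: "?diff G E" using add(2) by (rule exE)
  show ?case
  proof (rule exI[of _ "D + E"], intro allI impI)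
    fix \<gamma> :: "complex \<Rightarrow> 'a \<Rightarrow> complex"
    assume "\<gamma> 0 = p" "\<forall>i\<in>I. ((\<lambda>t. \<gamma> t i) has_field_derivative v i) (at 0)"
    then show "((\<lambda>t. F (\<gamma> t) + G (\<gamma> t)) has_field_derivative D + E) (at 0)"
      using D E by (intro DERIV_add) simp_all
  qed
next
  case (mult F G)
  obtain D where D: "?diff F D" using mult(1) by (rule exE)
  obtain E where E: "?diff G E" using mult(2) by (rule exE)
  show ?case
  proof (rule exI[of _ "D * G p + E * F p"], intro allI impI)
    fix \<gamma> :: "complex \<Rightarrow> 'a \<Rightarrow> complex"
    assume \<gamma>: "\<gamma> 0 = p" "\<forall>i\<in>I. ((\<lambda>t. \<gamma> t i) has_field_derivative v i) (at 0)"
    have "((\<lambda>t. F (\<gamma> t) * G (\<gamma> t)) has_field_derivative D * G (\<gamma> 0) + E * F (\<gamma> 0)) (at 0)"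
      using D E \<gamma> by (intro DERIV_mult) simp_all
    then show "((\<lambda>t. F (\<gamma> t) * G (\<gamma> t)) has_field_derivative D * G p + E * F p) (at 0)"
      by (simp add: \<gamma>)
  qed
qed auto

subsection \<open>Closures and cones\<close>

lemma affine_spaceD: "p \<in> affine_space I \<Longrightarrow> i \<notin> I \<Longrightarrow> p i = 0"
  by (simp add: affine_space_def)

lemma affine_space_cscale: "p \<in> affine_space I \<Longrightarrow> cscale t p \<in> affine_space I"
  by (simp add: affine_space_def cscale_def)

lemma cscale_apply: "cscale t v i = t * v i"
  by (simp add: cscale_def)

lemma sum_fun_apply: "(\<Sum>j\<in>J. f j) x = (\<Sum>j\<in>J. f j x)" for f :: "'j \<Rightarrow> 'a \<Rightarrow> complex"
  by (induction J rule: infinite_finite_induct) simp_all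

lemma cscale_cscale [simp]: "cscale s (cscale t p) = cscale (s * t) p"
  by (simp add: cscale_def mult.assoc)

lemma cscale_one [simp]: "cscale 1 p = p"
  by (simp add: cscale_def)

lemma cscale_eq_0_iff: "cscale t p = 0 \<longleftrightarrow> t = 0 \<or> p = 0"
  by (auto simp: cscale_def fun_eq_iff)

lemma zariski_closure_eq:
  assumes "Y \<subseteq> affine_space I"
  shows "zariski_closure I Y =
     {p \<in> affine_space I. \<forall>F\<in>poly_funs I. (\<forall>q\<in>Y. F q = 0) \<longrightarrow> F p = 0}" (is "_ = ?C")
proof
  have "zariski_closed I ?C"
    unfolding zariski_closed_def
    by (rule exI[of _ "{F\<in>poly_funs I. \<forall>q\<in>Y. F q = 0}"]) auto
  moreover have "Y \<subseteq> ?C"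
    using assms by auto
  ultimately show "zariski_closure I Y \<subseteq> ?C"
    unfolding zariski_closure_def by (simp add: hull_minimal)
  show "?C \<subseteq> zariski_closure I Y"
    unfolding zariski_closure_def hull_def zariski_closed_def by blast
qed

lemma zariski_closureD:
  assumes "Y \<subseteq> affine_space I" "p \<in> zariski_closure I Y" "F \<in> poly_funs I" "\<forall>q\<in>Y. F q = 0"
  shows "F p = 0"
proof -
  have "\<forall>F\<in>poly_funs I. (\<forall>q\<in>Y. F q = 0) \<longrightarrow> F p = 0"
    using assms(2) unfolding zariski_closure_eq[OF assms(1)] by simp
  from bspec[OF this assms(3)] show ?thesis
    using assms(4) by simp
qed

lemma zariski_closed_closure:
  assumes "Y \<subseteq> affine_space I"
  shows "zariski_closed I (zariski_closure I Y)"
  unfolding zariski_closure_eq[OF assms] zariski_closed_def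
  by (rule exI[of _ "{F\<in>poly_funs I. \<forall>q\<in>Y. F q = 0}"]) auto

lemma zariski_closure_superset: "Y \<subseteq> zariski_closure I Y"
  unfolding zariski_closure_def by (rule hull_subset)

lemma zariski_closure_mono: "Y \<subseteq> Y' \<Longrightarrow> zariski_closure I Y \<subseteq> zariski_closure I Y'"
  unfolding zariski_closure_def by (rule hull_mono)

lemma zariski_closed_separate:
  assumes "zariski_closed I C" "p \<in> affine_space I" "p \<notin> C"
  shows "\<exists>F\<in>poly_funs I. (\<forall>q\<in>C. F q = 0) \<and> F p \<noteq> 0"
  using assms unfolding zariski_closed_def by blast

lemma proj_point_self: "p \<in> proj_point p"
  unfolding proj_point_def by (auto intro!: exI[of _ 1])

lemma proj_point_cscale:
  assumes "t \<noteq> 0"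
  shows "proj_point (cscale t p) = proj_point p"
proof
  show "proj_point (cscale t p) \<subseteq> proj_point p"
    using assms unfolding proj_point_def by auto
  show "proj_point p \<subseteq> proj_point (cscale t p)"
  proof
    fix q assume "q \<in> proj_point p"
    then obtain s where "s \<noteq> 0" "q = cscale s p"
      unfolding proj_point_def by blast
    then have "q = cscale (s / t) (cscale t p)" "s / t \<noteq> 0"
      using assms by auto
    then show "q \<in> proj_point (cscale t p)"
      unfolding proj_point_def by blast
  qed
qed

lemma proj_point_eq:
  assumes "q \<in> proj_point p"
  shows "proj_point q = proj_point p"
proof -
  obtain t where "t \<noteq> 0" "q = cscale t p"
    using assms by (auto simp: proj_point_def)
  then show ?thesis
    by (simp add: proj_point_cscale)
qed

lemma affine_cone_subset: "X \<subseteq> proj_space I \<Longrightarrow> affine_cone X \<subseteq> affine_space I"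
  unfolding affine_cone_def proj_space_def proj_point_def
  by (auto intro: affine_space_cscale) (auto simp: affine_space_def)

lemma affine_cone_cscale:
  assumes "X \<subseteq> proj_space I" "p \<in> affine_cone X"
  shows "cscale t p \<in> affine_cone X"
proof (cases "p = 0 \<or> t = 0")
  case True
  then have "cscale t p = 0" by (auto simp: cscale_eq_0_iff)
  then show ?thesis by (simp add: affine_cone_def)
next
  case False
  then obtain x where x: "x \<in> X" "p \<in> x"
    using assms by (auto simp: affine_cone_def)
  then obtain q where "x = proj_point q"
    using assms by (auto simp: proj_space_def)
  then have "x = proj_point p"
    using x proj_point_eq[of p q] by simp
  moreover have "cscale t p \<in> proj_point p"
    using False by (auto simp: proj_point_def)
  ultimately have "cscale t p \<in> x"
    by simp
  then show ?thesis
    using x by (auto simp: affine_cone_def)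
qed

lemma proj_point_mem_iff:
  assumes "X \<subseteq> proj_space I" "p \<noteq> 0"
  shows "p \<in> affine_cone X \<longleftrightarrow> proj_point p \<in> X"
proof
  assume "p \<in> affine_cone X"
  then obtain x where x: "x \<in> X" "p \<in> x"
    using assms by (auto simp: affine_cone_def)
  then obtain q where "x = proj_point q"
    using assms by (auto simp: proj_space_def)
  then show "proj_point p \<in> X"
    using proj_point_eq x by metis
next
  assume "proj_point p \<in> X"
  then show "p \<in> affine_cone X"
    using proj_point_self by (auto simp: affine_cone_def)
qed

lemma affine_cone_mono_iff:
  assumes "X \<subseteq> proj_space I" "X' \<subseteq> proj_space I"
  shows "affine_cone X \<subseteq> affine_cone X' \<longleftrightarrow> X \<subseteq> X'"
proof
  assume *: "affine_cone X \<subseteq> affine_cone X'"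
  show "X \<subseteq> X'"
  proof
    fix x assume x: "x \<in> X"
    then obtain p where p: "x = proj_point p" "p \<noteq> 0"
      using assms by (auto simp: proj_space_def)
    then show "x \<in> X'"
      using * x proj_point_mem_iff[OF assms(1)] proj_point_mem_iff[OF assms(2)] by auto
  qed
qed (auto simp: affine_cone_def)

lemma affine_cone_zero: "0 \<in> affine_cone X"
  by (simp add: affine_cone_def)

lemma affine_cone_Un: "affine_cone (X \<union> X') = affine_cone X \<union> affine_cone X'"
  by (auto simp: affine_cone_def)

text \<open>The limit \<open>t \<rightarrow> 0\<close> along a ray, done algebraically. It puts the
  vertex into the closure of a scale-invariant set.\<close>

lemma poly_funs_scale_limit:
  assumes "F \<in> poly_funs I" "\<And>t. t \<noteq> 0 \<Longrightarrow> F (cscale t p) = 0"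
  shows "F 0 = 0"
proof -
  obtain q where q: "\<forall>t. F (\<lambda>i. poly [:0, p i:] t) = poly q t"
    using poly_funs_along_curve[OF assms(1), where g = "\<lambda>i. [:0, p i:]"] by blast
  have eq: "F (cscale t p) = poly q t" for t
    using spec[OF q, of t] by (simp add: cscale_def)
  \<comment> \<open>The factor \<open>t\<close> absorbs the one value \<open>t = 0\<close> at which
    nothing is known yet about \<open>q\<close>.\<close>
  have "poly ([:0, 1:] * q) t = 0" for t
    using eq[of t] assms(2)[of t] by (cases "t = 0") auto
  then have "q = 0"
    by (metis mult_eq_0_iff one_neq_zero pCons_eq_0_iff poly_all_0_iff_0)
  moreover have "cscale 0 p = 0" by (simp add: cscale_eq_0_iff)
  ultimately show ?thesis
    using eq[of 0] by simp
qed

text \<open>Scale invariance makes the closure of \<open>Y\<close> a cone, so that passing to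
  projective points and back with \<open>affine_cone\<close> returns the same closure. The instances
  are the images of the torus and of its subtori.\<close>

locale cone_generators =
  fixes I :: "'i set" and Y :: "('i \<Rightarrow> complex) set"
  assumes finite_index: "finite I"
    and subset_affine: "Y \<subseteq> affine_space I"
    and scale_invariant: "\<And>t p. t \<noteq> 0 \<Longrightarrow> p \<in> Y \<Longrightarrow> cscale t p \<in> Y"
    and nonempty: "Y \<noteq> {}"
begin

abbreviation "closed_cone \<equiv> zariski_closure I Y"
abbreviation "proj_cone \<equiv> proj_point ` (closed_cone - {0})"

lemma cone_scale:
  assumes "t \<noteq> 0" "p \<in> closed_cone"
  shows "cscale t p \<in> closed_cone"
  unfolding zariski_closure_eq[OF subset_affine]
proof (intro CollectI conjI ballI impI)
  show "cscale t p \<in> affine_space I"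
    using assms(2) by (simp add: zariski_closure_eq[OF subset_affine] affine_space_cscale)
  fix F assume F: "F \<in> poly_funs I" "\<forall>q\<in>Y. F q = 0"
  have "(\<lambda>q. F (cscale t q)) \<in> poly_funs I" "\<forall>q\<in>Y. F (cscale t q) = 0"
    using poly_funs_cscale[OF finite_index F(1)] F(2) scale_invariant assms(1) by auto
  from zariski_closureD[OF subset_affine assms(2) this] show "F (cscale t p) = 0" .
qed

lemma zero_in_cone: "0 \<in> closed_cone"
proof -
  obtain p where p: "p \<in> Y" using nonempty by blast
  show ?thesis
    unfolding zariski_closure_eq[OF subset_affine]
    using poly_funs_scale_limit[of _ I p] scale_invariant[OF _ p]
    by (auto simp: affine_space_def)
qed

lemma affine_cone_proj_cone: "affine_cone proj_cone = closed_cone"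
proof
  show "affine_cone proj_cone \<subseteq> closed_cone"
    using zero_in_cone cone_scale by (auto simp: affine_cone_def proj_point_def)
  show "closed_cone \<subseteq> affine_cone proj_cone"
    using proj_point_self by (auto simp: affine_cone_def)
qed

lemma proj_cone_subset: "proj_cone \<subseteq> proj_space I"
  using zariski_closure_eq[OF subset_affine] by (auto simp: proj_space_def)

lemma proj_closed_proj_cone: "proj_closed I proj_cone"
  by (simp add: proj_closed_def proj_cone_subset affine_cone_proj_cone
      zariski_closed_closure[OF subset_affine])

text \<open>A proper closed subset misses a point of the cone, hence lies in the zero set of some
  \<open>F\<close> that is not zero on all of \<open>Y\<close>, since otherwise \<open>F\<close>
  would vanish on the closure. Two proper closed subsets give \<open>F\<close> and \<open>G\<close>,
  and at a point of \<open>Y\<close> where \<open>F p * G p \<noteq> 0\<close> neither subset can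
  contain \<open>p\<close>.\<close>

lemma proj_irreducible_proj_cone:
  assumes prime: "\<And>F G. \<lbrakk>F \<in> poly_funs I; G \<in> poly_funs I; \<exists>p\<in>Y. F p \<noteq> 0; \<exists>p\<in>Y. G p \<noteq> 0\<rbrakk>
      \<Longrightarrow> \<exists>p\<in>Y. F p * G p \<noteq> 0"
    and nonzero: "Y \<noteq> {0}"
  shows "proj_irreducible I proj_cone"
  unfolding proj_irreducible_def
proof (intro conjI allI impI)
  show "proj_closed I proj_cone" by (rule proj_closed_proj_cone)
  show "proj_cone \<noteq> {}"
  proof -
    obtain p where "p \<in> Y" "p \<noteq> 0"
      using nonzero nonempty by blast
    then have "proj_point p \<in> proj_cone"
      using zariski_closure_superset[of Y I] by blast
    then show ?thesis by blast
  qed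
  fix Z1 Z2
  assume *: "proj_closed I Z1 \<and> proj_closed I Z2 \<and> proj_cone = Z1 \<union> Z2"
  have sep: "\<exists>F. F \<in> poly_funs I \<and> (\<forall>q\<in>affine_cone Z. F q = 0) \<and> (\<exists>p\<in>Y. F p \<noteq> 0)"
    if "proj_closed I Z" "Z \<subseteq> proj_cone" "Z \<noteq> proj_cone" for Z
  proof -
    have Z: "Z \<subseteq> proj_space I" "zariski_closed I (affine_cone Z)"
      using that(1) by (simp_all add: proj_closed_def)
    have "\<not> proj_cone \<subseteq> Z"
      using that(3) subset_antisym[OF that(2)] by (rule contrapos_nn)
    then have "\<not> closed_cone \<subseteq> affine_cone Z"
      using affine_cone_mono_iff[OF proj_cone_subset Z(1)] by (simp add: affine_cone_proj_cone)
    then obtain p where p: "p \<in> closed_cone" "p \<notin> affine_cone Z" by blast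
    then have aff: "p \<in> affine_space I"
      by (simp add: zariski_closure_eq[OF subset_affine])
    obtain F where F: "F \<in> poly_funs I" "\<forall>q\<in>affine_cone Z. F q = 0" "F p \<noteq> 0"
      using zariski_closed_separate[OF Z(2) aff p(2)] by blast
    moreover have "\<exists>p\<in>Y. F p \<noteq> 0"
      using F(1,3) zariski_closureD[OF subset_affine p(1) F(1)] by metis
    ultimately show ?thesis by blast
  qed
  show "proj_cone = Z1 \<or> proj_cone = Z2"
  proof (rule ccontr)
    assume "\<not> (proj_cone = Z1 \<or> proj_cone = Z2)"
    then have neq: "Z1 \<noteq> proj_cone" "Z2 \<noteq> proj_cone"
      by (simp_all only: de_Morgan_disj not_False_eq_True eq_commute)
    have sub: "Z1 \<subseteq> proj_cone" "Z2 \<subseteq> proj_cone"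
      using * by simp_all
    obtain F where F: "F \<in> poly_funs I" "\<forall>q\<in>affine_cone Z1. F q = 0" "\<exists>p\<in>Y. F p \<noteq> 0"
      using sep[OF _ sub(1) neq(1)] * by auto
    obtain G where G: "G \<in> poly_funs I" "\<forall>q\<in>affine_cone Z2. G q = 0" "\<exists>p\<in>Y. G p \<noteq> 0"
      using sep[OF _ sub(2) neq(2)] * by auto
    obtain p where p: "p \<in> Y" "F p * G p \<noteq> 0"
      using prime[OF F(1) G(1) F(3) G(3)] by blast
    have "p \<in> affine_cone (Z1 \<union> Z2)"
      using p(1) zariski_closure_superset[of Y I] affine_cone_proj_cone * by auto
    then have "p \<in> affine_cone Z1 \<union> affine_cone Z2"
      by (simp add: affine_cone_Un)
    then show False
      using F G p by auto
  qed
qed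

end

text \<open>Irreducibility only tests decompositions into cones; the sets \<open>{p. \<forall>t. F (t p) = 0}\<close> reduce
  arbitrary polynomial functions to that case.\<close>

lemma proj_irreducible_prime:
  assumes "finite I" "proj_irreducible I Z" "F \<in> poly_funs I" "G \<in> poly_funs I"
    and FG: "\<And>p. p \<in> affine_cone Z \<Longrightarrow> F p * G p = 0"
  shows "(\<forall>p\<in>affine_cone Z. F p = 0) \<or> (\<forall>p\<in>affine_cone Z. G p = 0)"
proof -
  have Z: "Z \<subseteq> proj_space I" "zariski_closed I (affine_cone Z)"
    and irr: "\<And>Z1 Z2. \<lbrakk>proj_closed I Z1; proj_closed I Z2; Z = Z1 \<union> Z2\<rbrakk> \<Longrightarrow> Z = Z1 \<or> Z = Z2"
    using assms(2) by (auto simp: proj_irreducible_def proj_closed_def)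
  \<comment> \<open>On the ray through \<open>p\<close> both functions are polynomials in
    \<open>t\<close> with zero product, so one of them is zero on the entire ray.\<close>
  have split: "(\<forall>t. F (cscale t p) = 0) \<or> (\<forall>t. G (cscale t p) = 0)" if "p \<in> affine_cone Z" for p
  proof -
    obtain f where f: "\<forall>t. F (\<lambda>i. poly [:0, p i:] t) = poly f t"
      using poly_funs_along_curve[OF assms(3), where g = "\<lambda>i. [:0, p i:]"] by blast
    obtain g where g: "\<forall>t. G (\<lambda>i. poly [:0, p i:] t) = poly g t"
      using poly_funs_along_curve[OF assms(4), where g = "\<lambda>i. [:0, p i:]"] by blast
    have eq: "F (cscale t p) = poly f t" "G (cscale t p) = poly g t" for t
      using spec[OF f, of t] spec[OF g, of t] by (simp_all add: cscale_def)
    have "poly (f * g) t = 0" for t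
      using FG[OF affine_cone_cscale[OF Z(1) that], of t] by (simp add: eq)
    then have "f = 0 \<or> g = 0"
      by (metis mult_eq_0_iff poly_all_0_iff_0)
    then show ?thesis by (auto simp: eq)
  qed
  have zero: "cscale 0 p = 0" for p :: "'a \<Rightarrow> complex"
    by (simp add: cscale_eq_0_iff)
  show ?thesis
  \<comment> \<open>An \<open>affine_cone\<close> always contains the vertex, so describing
    \<open>affine_cone (part H)\<close> below needs \<open>H 0 = 0\<close>. If instead
    \<open>F 0 \<noteq> 0\<close>, the first alternative of \<open>split\<close> fails at
    \<open>t = 0\<close> for every point, and \<open>G\<close> vanishes on the whole cone; likewise
    with \<open>F\<close> and \<open>G\<close> exchanged.\<close>
  proof (cases "F 0 = 0 \<and> G 0 = 0")
    case False
    then show ?thesis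
      using split zero cscale_one by metis
  next
    case True
    define part where "part H = {x \<in> Z. \<forall>p\<in>x. H p = 0}" for H :: "('a \<Rightarrow> complex) \<Rightarrow> complex"
    have cone: "affine_cone (part H) = {p \<in> affine_cone Z. \<forall>t. H (cscale t p) = 0}" if "H 0 = 0" for H
    proof (intro equalityI subsetI)
      fix p assume p: "p \<in> affine_cone (part H)"
      have "part H \<subseteq> proj_space I" using Z by (auto simp: part_def)
      then have "cscale t p \<in> affine_cone (part H)" for t
        using p affine_cone_cscale by blast
      moreover have "H q = 0" if "q \<in> affine_cone (part H)" for q
        using that \<open>H 0 = 0\<close> by (auto simp: affine_cone_def part_def)
      moreover have "affine_cone (part H) \<subseteq> affine_cone Z"
        by (auto simp: affine_cone_def part_def)
      ultimately show "p \<in> {p \<in> affine_cone Z. \<forall>t. H (cscale t p) = 0}"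
        using p by auto
    next
      fix p assume p: "p \<in> {p \<in> affine_cone Z. \<forall>t. H (cscale t p) = 0}"
      show "p \<in> affine_cone (part H)"
      proof (cases "p = 0")
        case False
        then have "proj_point p \<in> part H"
          using p proj_point_mem_iff[OF Z(1)] by (auto simp: part_def proj_point_def)
        then show ?thesis
          using proj_point_self by (auto simp: affine_cone_def)
      qed (simp add: affine_cone_zero)
    qed
    have closed: "proj_closed I (part H)" if "H 0 = 0" "H \<in> poly_funs I" for H
    proof -
      obtain S where S: "S \<subseteq> poly_funs I" "affine_cone Z = {p \<in> affine_space I. \<forall>F\<in>S. F p = 0}"
        using Z(2) unfolding zariski_closed_def by blast
      have "affine_cone (part H) =
          {p \<in> affine_space I. \<forall>F\<in>S \<union> range (\<lambda>t p. H (cscale t p)). F p = 0}"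
        unfolding cone[of H, OF that(1)] S(2) by auto
      moreover have "S \<union> range (\<lambda>t p. H (cscale t p)) \<subseteq> poly_funs I"
        using S poly_funs_cscale[OF assms(1) that(2)] by auto
      ultimately have "zariski_closed I (affine_cone (part H))"
        unfolding zariski_closed_def by (intro exI[of _ "S \<union> range (\<lambda>t p. H (cscale t p))"] conjI)
      moreover have "part H \<subseteq> proj_space I"
        using Z(1) by (auto simp: part_def)
      ultimately show ?thesis
        by (simp add: proj_closed_def)
    qed
    have "affine_cone Z \<subseteq> affine_cone (part F \<union> part G)"
      using split True by (auto simp: affine_cone_Un cone)
    then have "Z \<subseteq> part F \<union> part G"
      using affine_cone_mono_iff[of Z I "part F \<union> part G"] Z by (auto simp: part_def)
    then have "Z = part F \<union> part G"
      by (auto simp: part_def)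
    then have "Z = part F \<or> Z = part G"
      using irr[of "part F" "part G"] closed[of F] closed[of G] assms(3,4) True by simp
    then have "affine_cone Z = affine_cone (part F) \<or> affine_cone Z = affine_cone (part G)"
      by auto
    then have "(\<forall>p\<in>affine_cone Z. \<forall>t. F (cscale t p) = 0) \<or>
        (\<forall>p\<in>affine_cone Z. \<forall>t. G (cscale t p) = 0)"
      using True cone[of F] cone[of G] by auto
    then show ?thesis
      by (metis cscale_one)
  qed
qed

subsection \<open>Lengths of chains of irreducible sets\<close>

text \<open>Each exponent is bounded separately rather than the total degree: the count is then a
  plain power of \<open>Suc D\<close>, and bounds still add under multiplication.\<close>

definition bounded_monomials :: "'j set \<Rightarrow> nat \<Rightarrow> (('j \<Rightarrow> complex) \<Rightarrow> complex) set" where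
  "bounded_monomials J D = (\<lambda>e y. \<Prod>i\<in>J. y i ^ e i) ` (J \<rightarrow>\<^sub>E {..D})"

lemma finite_bounded_monomials: "finite J \<Longrightarrow> finite (bounded_monomials J D)"
  by (simp add: bounded_monomials_def finite_PiE)

lemma card_bounded_monomials:
  assumes "finite J"
  shows "card (bounded_monomials J D) \<le> Suc D ^ card J"
proof -
  have "card (bounded_monomials J D) \<le> card (J \<rightarrow>\<^sub>E {..D})"
    unfolding bounded_monomials_def by (rule card_image_le) (simp add: assms finite_PiE)
  then show ?thesis
    by (simp add: card_PiE assms)
qed

lemma bounded_monomialsI:
  assumes "\<And>i. i \<in> J \<Longrightarrow> e i \<le> D"
  shows "(\<lambda>y. \<Prod>i\<in>J. y i ^ e i) \<in> bounded_monomials J D"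
  unfolding bounded_monomials_def
  by (rule image_eqI[of _ _ "restrict e J"]) (auto simp: assms)

lemma span_bounded_monomials_mono:
  assumes "D \<le> E"
  shows "cfun.span (bounded_monomials J D) \<subseteq> cfun.span (bounded_monomials J E)"
  by (rule cfun.span_mono)
     (auto simp: bounded_monomials_def PiE_def Pi_def intro!: image_mono intro: order_trans[OF _ assms])

lemma span_bounded_monomials_mult:
  assumes "F \<in> cfun.span (bounded_monomials J D)" "G \<in> cfun.span (bounded_monomials J E)"
  shows "(\<lambda>y. F y * G y) \<in> cfun.span (bounded_monomials J (D + E))" (is "_ \<in> ?S")
proof -
  have mono: "(\<lambda>y. f y * g y) \<in> ?S"
    if f: "f \<in> bounded_monomials J D" and g: "g \<in> bounded_monomials J E" for f g
  proof -
    obtain a where a: "f = (\<lambda>y. \<Prod>i\<in>J. y i ^ a i)" "a \<in> J \<rightarrow>\<^sub>E {..D}"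
      using f by (auto simp: bounded_monomials_def)
    obtain b where b: "g = (\<lambda>y. \<Prod>i\<in>J. y i ^ b i)" "b \<in> J \<rightarrow>\<^sub>E {..E}"
      using g by (auto simp: bounded_monomials_def)
    have "(\<lambda>y. f y * g y) = (\<lambda>y. \<Prod>i\<in>J. y i ^ (a i + b i))"
      by (simp add: a b power_add prod.distrib)
    also have "\<dots> \<in> bounded_monomials J (D + E)"
      using a b by (intro bounded_monomialsI add_mono) auto
    finally show ?thesis
      by (rule cfun.span_base)
  qed
  have zero: "(\<lambda>y. 0) \<in> ?S"
    using cfun.span_zero[of "bounded_monomials J (D + E)"] by (simp add: zero_fun_def)
  have comb: "(\<lambda>y. t * f y + g y) \<in> ?S" if "f \<in> ?S" "g \<in> ?S" for t f g
    using cfun.span_add[OF cfun.span_scale[OF that(1), of t] that(2)]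
    by (simp add: cscale_apply plus_fun_def)
  have left: "(\<lambda>y. F y * g y) \<in> ?S" if g: "g \<in> bounded_monomials J E" for g
    using assms(1)
  proof (induction rule: cfun.span_induct_alt)
    case base
    then show ?case using zero by simp
  next
    case (step t f h)
    have "(\<lambda>y. (cscale t f + h) y * g y) = (\<lambda>y. t * (f y * g y) + h y * g y)"
      by (simp add: cscale_apply fun_eq_iff algebra_simps)
    also have "\<dots> \<in> ?S"
      by (rule comb[OF mono[OF step(1) g] step(2)])
    finally show ?case .
  qed
  show ?thesis
    using assms(2)
  proof (induction rule: cfun.span_induct_alt)
    case base
    then show ?case using zero by simp
  next
    case (step t f h)
    have "(\<lambda>y. F y * (cscale t f + h) y) = (\<lambda>y. t * (F y * f y) + F y * h y)"
      by (simp add: cscale_apply fun_eq_iff algebra_simps)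
    also have "\<dots> \<in> ?S"
      by (rule comb[OF left[OF step(1)] step(2)])
    finally show ?case .
  qed
qed

lemma span_bounded_monomials_const: "(\<lambda>y. c) \<in> cfun.span (bounded_monomials J D)"
proof -
  have "(\<lambda>y. 1) \<in> bounded_monomials J D"
    using bounded_monomialsI[of J "\<lambda>_. 0" D] by simp
  from cfun.span_scale[OF cfun.span_base[OF this], of c] show ?thesis
    by (simp add: cscale_def)
qed

lemma span_bounded_monomials_power:
  assumes "F \<in> cfun.span (bounded_monomials J D)"
  shows "(\<lambda>y. F y ^ n) \<in> cfun.span (bounded_monomials J (n * D))"
proof (induction n)
  case 0
  show ?case using span_bounded_monomials_const[of 1 J 0] by simp
next
  case (Suc n)
  show ?case using span_bounded_monomials_mult[OF assms Suc] by simp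
qed

lemma span_bounded_monomials_prod:
  assumes "\<And>j. j < n \<Longrightarrow> F j \<in> cfun.span (bounded_monomials J D)"
  shows "(\<lambda>y. \<Prod>j<n. F j y) \<in> cfun.span (bounded_monomials J (n * D))"
  using assms
proof (induction n)
  case 0
  show ?case using span_bounded_monomials_const[of 1 J 0] by simp
next
  case (Suc n)
  then show ?case
    using span_bounded_monomials_mult[of "F n" J D "\<lambda>y. \<Prod>j<n. F j y" "n * D"]
    by (simp add: mult.commute)
qed

lemma poly_funs_degree_bound:
  assumes "finite J" "F \<in> poly_funs J"
  shows "\<exists>D. F \<in> cfun.span (bounded_monomials J D)"
  using assms(2)
proof (induction rule: poly_funs_induct)
  case (const c)
  then show ?case using span_bounded_monomials_const by blast
next
  case (coord i)
  have "(\<Prod>j\<in>J. p j ^ (if j = i then 1 else 0)) = p i" for p :: "'a \<Rightarrow> complex"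
    using assms coord by (simp add: if_distrib[of "(^) _"] cong: if_cong)
  then have "(\<lambda>p. p i) \<in> bounded_monomials J 1"
    using bounded_monomialsI[of J "\<lambda>j. if j = i then 1 else 0" 1] by simp
  then show ?case
    by (blast intro: cfun.span_base)
next
  case (add F G)
  then obtain D E where
    "F \<in> cfun.span (bounded_monomials J D)" "G \<in> cfun.span (bounded_monomials J E)"
    by auto
  then have "F \<in> cfun.span (bounded_monomials J (max D E))"
    "G \<in> cfun.span (bounded_monomials J (max D E))"
    using span_bounded_monomials_mono[of D "max D E" J] span_bounded_monomials_mono[of E "max D E" J]
    by auto
  from cfun.span_add[OF this] show ?case
    by (auto simp: plus_fun_def)
next
  case (mult F G)
  then obtain D E where
    "F \<in> cfun.span (bounded_monomials J D)" "G \<in> cfun.span (bounded_monomials J E)"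
    by auto
  then show ?case
    using span_bounded_monomials_mult by blast
qed

text \<open>The products of the \<open>G j\<close> with exponents at most \<open>N\<close> number
  \<open>(N + 1) ^ n\<close>, while they all lie in the span of at most
  \<open>(n * N * D + 1) ^ card J\<close> monomials. As \<open>card J < n\<close>, the first number
  wins for large \<open>N\<close>, which forces a linear relation.\<close>

lemma poly_funs_algebraically_dependent:
  fixes G :: "nat \<Rightarrow> ('j \<Rightarrow> complex) \<Rightarrow> complex"
  assumes J: "finite J" "card J < n" and G: "\<And>j. j < n \<Longrightarrow> G j \<in> poly_funs J"
  shows "\<exists>M r. finite M \<and> M \<noteq> {} \<and> M \<subseteq> extensional {..<n} \<and> (\<forall>m\<in>M. r m \<noteq> 0) \<and>
     (\<forall>y. (\<Sum>m\<in>M. r m * (\<Prod>j<n. G j y ^ m j)) = 0)"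
proof -
  have "\<forall>j\<in>{..<n}. \<exists>D. G j \<in> cfun.span (bounded_monomials J D)"
    using poly_funs_degree_bound[OF J(1) G] by blast
  then obtain deg where deg: "\<forall>j\<in>{..<n}. G j \<in> cfun.span (bounded_monomials J (deg j))"
    by (rule bchoice[THEN exE])
  define D where "D = (\<Sum>j<n. deg j)"
  have D: "G j \<in> cfun.span (bounded_monomials J D)" if "j < n" for j
  proof -
    have "deg j \<le> D"
      unfolding D_def using that by (intro member_le_sum) auto
    then show ?thesis
      using deg span_bounded_monomials_mono[of "deg j" D J] that by blast
  qed
  \<comment> \<open>Chosen so that \<open>(n * N * D + 1) ^ card J \<le> (Suc (n * D) * Suc N) ^
    card J = N * Suc N ^ card J\<close>, which is strictly below
    \<open>Suc N ^ Suc (card J)\<close>.\<close>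
  define N where "N = Suc (n * D) ^ card J"
  define W where "W = bounded_monomials J (n * (N * D))"
  define E where "E = ({..<n} \<rightarrow>\<^sub>E {..N})"
  define P where "P m = (\<lambda>y. \<Prod>j<n. G j y ^ m j)" for m :: "nat \<Rightarrow> nat"
  have finE: "finite E" and cardE: "card E = Suc N ^ n"
    by (simp_all add: E_def finite_PiE card_PiE)
  have P_span: "P m \<in> cfun.span W" if "m \<in> E" for m
    unfolding P_def W_def
  proof (rule span_bounded_monomials_prod)
    fix j assume "j < n"
    then have "m j \<le> N"
      using that by (auto simp: E_def)
    then show "(\<lambda>y. G j y ^ m j) \<in> cfun.span (bounded_monomials J (N * D))"
      using span_bounded_monomials_power[OF D[OF \<open>j < n\<close>], of "m j"]
        span_bounded_monomials_mono[of "m j * D" "N * D" J] by auto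
  qed
  have "card W \<le> Suc (n * (N * D)) ^ card J"
    unfolding W_def by (rule card_bounded_monomials[OF J(1)])
  also have "\<dots> \<le> (Suc (n * D) * Suc N) ^ card J"
    by (intro power_mono) (simp_all add: algebra_simps)
  also have "\<dots> = N * Suc N ^ card J"
    by (simp only: power_mult_distrib N_def)
  also have "\<dots> < Suc N * Suc N ^ card J"
    by (intro mult_strict_right_mono) simp_all
  also have "\<dots> = Suc N ^ Suc (card J)"
    by simp
  also have "\<dots> \<le> Suc N ^ n"
    using J(2) by (intro power_increasing) simp_all
  finally have card: "card W < card E"
    by (simp add: cardE)
  show ?thesis
  \<comment> \<open>Linear independence concerns sets of functions and does not see coincidences. If
    two exponents give the same function, their difference is already a relation.\<close>
  proof (cases "inj_on P E")
    case False
    then obtain a b where ab: "a \<in> E" "b \<in> E" "a \<noteq> b" "P a = P b"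
      by (auto simp: inj_on_def)
    have "(\<Prod>j<n. G j y ^ a j) = (\<Prod>j<n. G j y ^ b j)" for y
      using fun_cong[OF ab(4), of y] by (simp add: P_def)
    then show ?thesis
      using ab by (intro exI[of _ "{a, b}"] exI[of _ "\<lambda>m. if m = a then 1 else - 1"])
        (auto simp: E_def PiE_def)
  next
    case True
    have "\<not> cfun.independent (P ` E)"
    proof
      assume "cfun.independent (P ` E)"
      moreover have "P ` E \<subseteq> cfun.span W" "finite W"
        using P_span J(1) by (auto simp: W_def finite_bounded_monomials)
      ultimately have "card (P ` E) \<le> card W"
        using cfun.independent_span_bound by blast
      then show False
        using card True by (simp add: card_image)
    qed
    then obtain u where u: "\<exists>v\<in>P ` E. u v \<noteq> 0" "(\<Sum>v\<in>P ` E. cscale (u v) v) = 0"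
      using cfun.dependent_finite[of "P ` E"] finE by auto
    \<comment> \<open>Only exponents with nonzero coefficient are kept, so that the relation has
      nonempty support and no vacuous terms.\<close>
    have *: "(\<Sum>m\<in>{m\<in>E. u (P m) \<noteq> 0}. u (P m) * (\<Prod>j<n. G j y ^ m j)) = 0" for y
    proof -
      have "(\<Sum>m\<in>{m\<in>E. u (P m) \<noteq> 0}. u (P m) * (\<Prod>j<n. G j y ^ m j)) = (\<Sum>m\<in>E. u (P m) * P m y)"
        unfolding P_def by (rule sum.mono_neutral_left) (use finE in auto)
      also have "\<dots> = (\<Sum>v\<in>P ` E. cscale (u v) v) y"
        by (simp add: sum.reindex[OF True] cscale_apply sum_fun_apply)
      finally show ?thesis
        by (simp add: u)
    qed
    have "E \<subseteq> extensional {..<n}"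
      by (auto simp: E_def PiE_def)
    then show ?thesis
      by (intro exI[of _ "{m\<in>E. u (P m) \<noteq> 0}"] exI[of _ "\<lambda>m. u (P m)"])
        (use * finE u(1) in auto)
  qed
qed

text \<open>Polynomial functions separating the members of a chain of prime sets are algebraically
  independent on the largest one: after dividing a relation by the maximal power of the last
  function, restriction to the previous set yields a shorter relation. Exponents beyond \<open>n\<close> are
  kept equal so that distinct exponents stay distinct monomials.\<close>

lemma separating_functions_algebraically_independent:
  fixes F :: "nat \<Rightarrow> ('i \<Rightarrow> complex) \<Rightarrow> complex"
  assumes "\<And>j. j < n \<Longrightarrow> F j \<in> poly_funs I"
    and "\<And>j p. j < n \<Longrightarrow> p \<in> C j \<Longrightarrow> F j p = 0"
    and "\<And>j. j < n \<Longrightarrow> \<exists>p\<in>C (Suc j). F j p \<noteq> 0"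
    and "\<And>j. j < n \<Longrightarrow> C j \<subseteq> C (Suc j)"
    and "\<And>j G H. \<lbrakk>j < n; G \<in> poly_funs I; H \<in> poly_funs I; \<forall>p\<in>C (Suc j). G p * H p = 0\<rbrakk>
       \<Longrightarrow> (\<forall>p\<in>C (Suc j). G p = 0) \<or> (\<forall>p\<in>C (Suc j). H p = 0)"
    and "C 0 \<noteq> {}"
    and "finite M" "M \<noteq> {}" "\<And>m. m \<in> M \<Longrightarrow> r m \<noteq> 0"
    and "\<And>m m' i. m \<in> M \<Longrightarrow> m' \<in> M \<Longrightarrow> n \<le> i \<Longrightarrow> m i = m' i"
  shows "\<exists>p\<in>C n. (\<Sum>m\<in>M. r m * (\<Prod>j<n. F j p ^ m j)) \<noteq> 0"
  using assms
proof (induction n arbitrary: M)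
  case 0
  then obtain m p where m: "m \<in> M" and p: "p \<in> C 0" by blast
  then have "M = {m}"
    using 0(10) by (auto simp: fun_eq_iff)
  then show ?case
    using 0(9) p by auto
next
  case (Suc n)
  \<comment> \<open>The least exponent of \<open>F n\<close>, so \<open>F n ^ e\<close> is the power
    that can be divided out of every term.\<close>
  define e where "e = Min ((\<lambda>m. m n) ` M)"
  have e: "e \<le> m n" if "m \<in> M" for m
    using Suc.prems(7) that by (simp add: e_def)
  define M' where "M' = {m\<in>M. m n = e}"
  have "e \<in> (\<lambda>m. m n) ` M"
    unfolding e_def using Suc.prems(7,8) by (intro Min_in) auto
  then have "M' \<noteq> {}" by (auto simp: M'_def)
  moreover have "m i = m' i" if "m \<in> M'" "m' \<in> M'" "n \<le> i" for m m' i
    using that Suc.prems(10)[of m m' i] by (cases "i = n") (auto simp: M'_def)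
  ultimately have IH: "\<exists>p\<in>C n. (\<Sum>m\<in>M'. r m * (\<Prod>j<n. F j p ^ m j)) \<noteq> 0"
    using Suc.prems by (intro Suc.IH) (auto simp: M'_def)
  define Q where "Q p = (\<Sum>m\<in>M. r m * (\<Prod>j<n. F j p ^ m j) * F n p ^ (m n - e))" for p
  have Q: "Q \<in> poly_funs I"
    unfolding Q_def
    by (intro poly_funs_sum poly_funs_mult poly_funs_const poly_funs_prod poly_funs_power Suc.prems) auto
  have factor: "(\<Sum>m\<in>M. r m * (\<Prod>j<Suc n. F j p ^ m j)) = F n p ^ e * Q p" for p
    unfolding Q_def sum_distrib_left
  proof (rule sum.cong)
    fix m assume "m \<in> M"
    then have "F n p ^ m n = F n p ^ e * F n p ^ (m n - e)"
      using e by (simp flip: power_add)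
    then show "r m * (\<Prod>j<Suc n. F j p ^ m j) =
        F n p ^ e * (r m * (\<Prod>j<n. F j p ^ m j) * F n p ^ (m n - e))"
      by simp
  qed simp
  have restrict: "Q p = (\<Sum>m\<in>M'. r m * (\<Prod>j<n. F j p ^ m j))" if "p \<in> C n" for p
  proof -
    \<comment> \<open>On \<open>C n\<close> the function \<open>F n\<close> is zero, and
      \<open>0 ^ (m n - e)\<close> is \<open>1\<close> exactly when \<open>m n = e\<close>; only the
      terms from \<open>M'\<close> survive.\<close>
    have "Q p = (\<Sum>m\<in>M. if m n = e then r m * (\<Prod>j<n. F j p ^ m j) else 0)"
      unfolding Q_def
    proof (rule sum.cong)
      fix m assume "m \<in> M"
      then show "r m * (\<Prod>j<n. F j p ^ m j) * F n p ^ (m n - e) =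
          (if m n = e then r m * (\<Prod>j<n. F j p ^ m j) else 0)"
        using e[of m] Suc.prems(2)[of n p] that by auto
    qed simp
    then show ?thesis
      using Suc.prems(7) by (simp add: M'_def sum.inter_filter)
  qed
  obtain p where "p \<in> C n" "Q p \<noteq> 0"
    using IH restrict by auto
  then have "\<exists>p\<in>C (Suc n). Q p \<noteq> 0"
    using Suc.prems(4)[of n] by auto
  moreover have "\<exists>p\<in>C (Suc n). F n p ^ e \<noteq> 0"
    using Suc.prems(3)[of n] by auto
  moreover have "(\<lambda>p. F n p ^ e) \<in> poly_funs I"
    using Suc.prems(1) by (intro poly_funs_power) simp
  \<comment> \<open>Primality of the larger set \<open>C (Suc n)\<close>: neither factor vanishes on
    all of it, so neither does the product.\<close>
  ultimately have "\<exists>p\<in>C (Suc n). F n p ^ e * Q p \<noteq> 0"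
    using Suc.prems(5)[of n "\<lambda>p. F n p ^ e" Q] Q by blast
  then show ?case
    unfolding factor .
qed

text \<open>The separating functions of the chain are independent on the cone over
  \<open>Z m\<close>. Pulled back along \<open>\<phi>\<close>, more than \<open>card J\<close> of
  them would satisfy a relation; it would hold on the image of \<open>\<phi>\<close>, hence on its
  closure, which contains that cone.\<close>

lemma irreducible_chain_length_le:
  assumes I: "finite I" and J: "finite J"
    and \<phi>: "\<And>i. i \<in> I \<Longrightarrow> (\<lambda>y. \<phi> y i) \<in> poly_funs J" "\<phi> ` S \<subseteq> affine_space I"
    and irr: "\<And>j. j \<le> m \<Longrightarrow> proj_irreducible I (Z j)"
    and chain: "\<And>j. j < m \<Longrightarrow> Z j \<subset> Z (Suc j)"
    and top: "affine_cone (Z m) \<subseteq> zariski_closure I (\<phi> ` S)"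
  shows "Suc m \<le> card J"
proof (rule ccontr)
  assume "\<not> Suc m \<le> card J"
  then have less: "card J < Suc m" by simp
  \<comment> \<open>The vertex is put in front of the chain. This extra strict inclusion turns
    \<open>m\<close> steps into \<open>Suc m\<close> separating functions and accounts for the cone
    having one dimension more than the projective set.\<close>
  define C where "C j = (case j of 0 \<Rightarrow> {0} | Suc j \<Rightarrow> affine_cone (Z j))" for j
  have C_simps: "C 0 = {0}" "\<And>j. C (Suc j) = affine_cone (Z j)"
    by (simp_all add: C_def)
  have sub: "Z j \<subseteq> proj_space I" "zariski_closed I (affine_cone (Z j))" "Z j \<noteq> {}" if "j \<le> m" for j
    using irr[OF that] by (auto simp: proj_irreducible_def proj_closed_def)
  have less_C: "C j \<subset> C (Suc j)" if "j \<le> m" for j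
  proof (cases j)
    case 0
    obtain x where x: "x \<in> Z 0" using sub[of 0] by auto
    then obtain p where "p \<noteq> 0" "x = proj_point p"
      using sub[of 0] by (auto simp: proj_space_def)
    then show ?thesis
      using x proj_point_mem_iff[of "Z 0" I p] sub[of 0] 0 by (auto simp: C_simps affine_cone_zero)
  next
    case (Suc i)
    then have "Z i \<subset> Z j" using chain[of i] that by simp
    then show ?thesis
      using affine_cone_mono_iff[of "Z i" I "Z j"] affine_cone_mono_iff[of "Z j" I "Z i"]
        sub[of i] sub[of j] that Suc by (simp add: C_simps psubset_eq) blast
  qed
  have "\<exists>F\<in>poly_funs I. (\<forall>p\<in>C j. F p = 0) \<and> (\<exists>p\<in>C (Suc j). F p \<noteq> 0)" if j: "j \<le> m" for j
  proof -
    obtain p where p: "p \<in> C (Suc j)" "p \<notin> C j" using less_C[OF j] by (auto simp: psubset_eq)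
    have aff: "p \<in> affine_space I"
      using p(1) affine_cone_subset[OF sub(1)[OF j]] by (auto simp: C_simps)
    have "\<exists>F\<in>poly_funs I. (\<forall>q\<in>C j. F q = 0) \<and> F p \<noteq> 0"
    proof (cases j)
      case 0
      then have "p \<noteq> 0" using p(2) by (simp add: C_simps)
      then obtain i where i: "p i \<noteq> 0" by (auto simp: fun_eq_iff)
      then have "i \<in> I" using affine_spaceD[OF aff] by blast
      then show ?thesis
        using i 0 poly_funs_coord[OF I, of i] by (intro bexI[of _ "\<lambda>p. p i"]) (auto simp: C_simps)
    next
      case (Suc i)
      then show ?thesis
        using zariski_closed_separate[of I "C j" p] sub(2)[of i] j aff p(2) by (simp add: C_simps)
    qed
    then show ?thesis using p(1) by blast
  qed
  then have "\<forall>j\<in>{..m}. \<exists>F. F \<in> poly_funs I \<and> (\<forall>p\<in>C j. F p = 0) \<and> (\<exists>p\<in>C (Suc j). F p \<noteq> 0)"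
    by blast
  then obtain F where F: "\<forall>j\<in>{..m}. F j \<in> poly_funs I \<and> (\<forall>p\<in>C j. F j p = 0) \<and> (\<exists>p\<in>C (Suc j). F j p \<noteq> 0)"
    by (rule bchoice[THEN exE])
  have "\<exists>M r. finite M \<and> M \<noteq> {} \<and> M \<subseteq> extensional {..<Suc m} \<and> (\<forall>m\<in>M. r m \<noteq> 0) \<and>
     (\<forall>y. (\<Sum>e\<in>M. r e * (\<Prod>j<Suc m. F j (\<phi> y) ^ e j)) = 0)"
  proof (rule poly_funs_algebraically_dependent[OF J less])
    fix j assume "j < Suc m"
    then show "(\<lambda>y. F j (\<phi> y)) \<in> poly_funs J"
      using F by (intro poly_funs_compose[OF _ \<phi>(1)]) auto
  qed
  then obtain M and r :: "(nat \<Rightarrow> nat) \<Rightarrow> complex"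
    where M: "finite M" "M \<noteq> {}" "M \<subseteq> extensional {..<Suc m}" "\<forall>m\<in>M. r m \<noteq> 0"
      and rel: "\<forall>y. (\<Sum>e\<in>M. r e * (\<Prod>j<Suc m. F j (\<phi> y) ^ e j)) = 0"
    by blast
  define H where "H p = (\<Sum>e\<in>M. r e * (\<Prod>j<Suc m. F j p ^ e j))" for p
  have "\<exists>p\<in>C (Suc m). H p \<noteq> 0"
    unfolding H_def
  proof (rule separating_functions_algebraically_independent[where C = C and F = F and I = I])
    fix j G K assume "j < Suc m" "G \<in> poly_funs I" "K \<in> poly_funs I" "\<forall>p\<in>C (Suc j). G p * K p = 0"
    then show "(\<forall>p\<in>C (Suc j). G p = 0) \<or> (\<forall>p\<in>C (Suc j). K p = 0)"
      unfolding C_simps using proj_irreducible_prime[OF I irr[of j], of G K] by simp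
  next
    fix a b i assume "a \<in> M" "b \<in> M" "Suc m \<le> i"
    then show "a i = b i"
      using M(3) extensional_arb[of _ "{..<Suc m}" i] by (metis lessThan_iff not_less subsetD)
  qed (use F M less_C in \<open>auto simp: C_simps(1) less_Suc_eq_le psubset_eq\<close>)
  then obtain p where p: "p \<in> zariski_closure I (\<phi> ` S)" "H p \<noteq> 0"
    using top by (auto simp: C_simps)
  have "H \<in> poly_funs I"
    unfolding H_def using F
    by (intro poly_funs_sum poly_funs_mult poly_funs_const poly_funs_prod poly_funs_power) auto
  moreover have "\<forall>q\<in>\<phi> ` S. H q = 0"
    using rel by (simp add: H_def)
  ultimately show False
    using zariski_closureD[OF \<phi>(2) p(1)] p(2) by blast
qed

subsection \<open>The torus of the scaled Veronese variety\<close>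

lemma finite_veronese_exponents: "finite (veronese_exponents d k)"
proof (rule finite_subset)
  show "veronese_exponents d k \<subseteq> {f. \<forall>x. (x \<in> {1..<d} \<longrightarrow> f x \<in> {..k}) \<and> (x \<notin> {1..<d} \<longrightarrow> f x = 0)}"
  proof
    fix a assume a: "a \<in> veronese_exponents d k"
    have "a x \<le> k" if "x \<in> {1..<d}" for x
      using member_le_sum[of x "{1..<d}" a] a that by (simp add: veronese_exponents_def)
    then show "a \<in> {f. \<forall>x. (x \<in> {1..<d} \<longrightarrow> f x \<in> {..k}) \<and> (x \<notin> {1..<d} \<longrightarrow> f x = 0)}"
      using a by (auto simp: veronese_exponents_def)
  qed
qed (rule finite_set_of_finite_funs; simp)

definition unit_exponent :: "nat \<Rightarrow> nat \<Rightarrow> nat" where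
  "unit_exponent i = (\<lambda>j. if j = i then 1 else 0)"

lemma zero_in_veronese_exponents: "(\<lambda>_. 0) \<in> veronese_exponents d k"
  by (simp add: veronese_exponents_def)

lemma unit_in_veronese_exponents:
  assumes "i \<in> {1..<d}" "k \<ge> 1"
  shows "unit_exponent i \<in> veronese_exponents d k"
  using assms by (auto simp: veronese_exponents_def unit_exponent_def)

lemma theta_monomial_zero: "theta_monomial d \<theta> (\<lambda>_. 0) = 1"
  by (simp add: theta_monomial_def)

lemma theta_monomial_unit:
  assumes "i \<in> {1..<d}"
  shows "theta_monomial d \<theta> (unit_exponent i) = \<theta> i"
  using assms by (simp add: theta_monomial_def unit_exponent_def if_distrib[of "(^) _"] cong: if_cong)

text \<open>The logarithmic form of the product rule: dividing by nonzero factors turns exponents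
  into linear weights, which is how they appear in \<open>log_tangent\<close>.\<close>

lemma has_field_derivative_monomial:
  fixes g :: "'i \<Rightarrow> complex \<Rightarrow> complex"
  assumes "\<And>i. i \<in> A \<Longrightarrow> (g i has_field_derivative g' i) (at z)" "\<And>i. i \<in> A \<Longrightarrow> g i z \<noteq> 0"
  shows "((\<lambda>t. \<Prod>i\<in>A. g i t ^ n i) has_field_derivative
     (\<Prod>i\<in>A. g i z ^ n i) * (\<Sum>i\<in>A. of_nat (n i) * (g' i / g i z))) (at z)"
proof -
  have "((\<lambda>t. \<Prod>i\<in>A. g i t ^ n i) has_field_derivative
     (\<Prod>i\<in>A. g i z ^ n i) * (\<Sum>i\<in>A. (of_nat (n i) * (g' i * g i z ^ (n i - 1))) / g i z ^ n i)) (at z)"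
    using assms by (intro has_field_derivative_prod') (auto intro!: derivative_eq_intros)
  also have "(\<Sum>i\<in>A. (of_nat (n i) * (g' i * g i z ^ (n i - 1))) / g i z ^ n i) =
      (\<Sum>i\<in>A. of_nat (n i) * (g' i / g i z))"
  proof (rule sum.cong)
    fix i assume "i \<in> A"
    then show "(of_nat (n i) * (g' i * g i z ^ (n i - 1))) / g i z ^ n i = of_nat (n i) * (g' i / g i z)"
      using assms(2)[of i] by (cases "n i") auto
  qed simp
  finally show ?thesis .
qed

locale scaled_monomials =
  fixes d k :: nat and c :: "(nat \<Rightarrow> nat) \<Rightarrow> complex"
  assumes d: "d \<ge> 1" and k: "k \<ge> 1"
    and c_nonzero: "\<And>a. a \<in> veronese_exponents d k \<Longrightarrow> c a \<noteq> 0"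
begin

abbreviation "I \<equiv> veronese_exponents d k"
abbreviation "X \<equiv> scaled_veronese d k c"

text \<open>The coordinate \<open>y 0\<close> plays the role of the scale \<open>s\<close>.\<close>

definition monomial_point :: "(nat \<Rightarrow> complex) \<Rightarrow> (nat \<Rightarrow> nat) \<Rightarrow> complex" where
  "monomial_point y = (\<lambda>a. if a \<in> I then c a * y 0 * theta_monomial d y a else 0)"

definition torus :: "(nat \<Rightarrow> complex) set" where
  "torus = {y. \<forall>i<d. y i \<noteq> 0}"

text \<open>The scale and the first \<open>j\<close> parameters stay free. Projectively its image
  has dimension \<open>j\<close>: for \<open>j = 0\<close> it is the single point of
  \<open>y\<close>, and for \<open>j = d - 1\<close> the whole torus.\<close>

definition frozen_torus :: "(nat \<Rightarrow> complex) \<Rightarrow> nat \<Rightarrow> (nat \<Rightarrow> complex) set" where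
  "frozen_torus y j = {z \<in> torus. \<forall>i. j < i \<and> i < d \<longrightarrow> z i = y i}"

lemma monomial_point_cong:
  assumes "\<And>i. i < d \<Longrightarrow> y i = z i"
  shows "monomial_point y = monomial_point z"
  using assms d by (auto simp: monomial_point_def theta_monomial_def fun_eq_iff)

lemma scaled_veronese_torus_eq: "scaled_veronese_torus d k c = monomial_point ` torus"
proof (intro equalityI subsetI)
  fix p assume "p \<in> scaled_veronese_torus d k c"
  then obtain s \<theta> where p: "p = (\<lambda>a. if a \<in> I then c a * s * theta_monomial d \<theta> a else 0)"
    and s: "s \<noteq> 0" "\<forall>i\<in>{1..<d}. \<theta> i \<noteq> 0"
    by (auto simp: scaled_veronese_torus_def)
  have "p = monomial_point (\<theta>(0 := s))"
    unfolding p by (auto simp: monomial_point_def theta_monomial_def fun_eq_iff)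
  moreover have "\<theta>(0 := s) \<in> torus"
    using s by (auto simp: torus_def)
  ultimately show "p \<in> monomial_point ` torus"
    by blast
next
  fix p assume "p \<in> monomial_point ` torus"
  then obtain y where "y \<in> torus" "p = monomial_point y" by blast
  then show "p \<in> scaled_veronese_torus d k c"
    using d unfolding scaled_veronese_torus_def torus_def monomial_point_def
    by (intro CollectI exI[of _ "y 0"] exI[of _ y]) auto
qed

lemma monomial_point_affine: "monomial_point y \<in> affine_space I"
  by (simp add: monomial_point_def affine_space_def)

lemma image_affine: "monomial_point ` S \<subseteq> affine_space I"
  using monomial_point_affine by blast

lemma monomial_point_poly_funs: "(\<lambda>y. monomial_point y a) \<in> poly_funs {..<d}"
proof (cases "a \<in> I")
  case True
  have "(\<lambda>y. c a * y 0 * (\<Prod>i=1..<d. y i ^ a i)) \<in> poly_funs {..<d}"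
    using d by (intro poly_funs_mult poly_funs_const poly_funs_coord poly_funs_prod poly_funs_power) auto
  then show ?thesis
    using True by (simp add: monomial_point_def theta_monomial_def)
qed (auto simp: monomial_point_def)

lemma monomial_point_nonzero:
  assumes "y \<in> torus" "a \<in> I"
  shows "monomial_point y a \<noteq> 0"
  using assms d c_nonzero by (auto simp: monomial_point_def theta_monomial_def torus_def)

lemma cscale_monomial_point: "cscale t (monomial_point y) = monomial_point (y(0 := t * y 0))"
  by (auto simp: cscale_def monomial_point_def theta_monomial_def fun_eq_iff)

lemma monomial_point_zero_exponent: "monomial_point y (\<lambda>_. 0) = c (\<lambda>_. 0) * y 0"
  by (simp add: monomial_point_def zero_in_veronese_exponents theta_monomial_zero)

lemma monomial_point_unit_exponent:
  assumes "i \<in> {1..<d}"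
  shows "monomial_point y (unit_exponent i) = c (unit_exponent i) * y 0 * y i"
  using assms k by (simp add: monomial_point_def unit_in_veronese_exponents theta_monomial_unit)

section \<open>Closures of subtori and the local dimension\<close>

lemma frozen_torus_subset: "frozen_torus y j \<subseteq> torus"
  by (auto simp: frozen_torus_def)

lemma frozen_torus_self: "y \<in> torus \<Longrightarrow> y \<in> frozen_torus y j"
  by (auto simp: frozen_torus_def)

lemma frozen_torus_mono: "frozen_torus y j \<subseteq> frozen_torus y (Suc j)"
  by (auto simp: frozen_torus_def)

lemma frozen_torus_top: "frozen_torus y (d - 1) = torus"
  by (auto simp: frozen_torus_def)

lemma cone_generators_frozen:
  assumes "y \<in> torus"
  shows "cone_generators I (monomial_point ` frozen_torus y j)"
proof
  show "monomial_point ` frozen_torus y j \<noteq> {}"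
    using frozen_torus_self[OF assms] by blast
  fix t :: complex and p assume "t \<noteq> 0" "p \<in> monomial_point ` frozen_torus y j"
  then obtain z where z: "z \<in> frozen_torus y j" "p = monomial_point z" by blast
  then have "z(0 := t * z 0) \<in> frozen_torus y j"
    using \<open>t \<noteq> 0\<close> d by (auto simp: frozen_torus_def torus_def)
  then show "cscale t p \<in> monomial_point ` frozen_torus y j"
    unfolding z cscale_monomial_point by blast
qed (rule finite_veronese_exponents image_affine)+

lemma frozen_torus_prime:
  assumes F: "F \<in> poly_funs I" "\<exists>p\<in>monomial_point ` frozen_torus y j. F p \<noteq> 0"
    and G: "G \<in> poly_funs I" "\<exists>p\<in>monomial_point ` frozen_torus y j. G p \<noteq> 0"
  shows "\<exists>p\<in>monomial_point ` frozen_torus y j. F p * G p \<noteq> 0"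
proof -
  obtain u where u: "u \<in> frozen_torus y j" "F (monomial_point u) \<noteq> 0" using F by blast
  obtain w where w: "w \<in> frozen_torus y j" "G (monomial_point w) \<noteq> 0" using G by blast
  define g where "g i = [:u i, w i - u i:]" for i
  have FG: "(\<lambda>y. F (monomial_point y)) \<in> poly_funs {..<d}" "(\<lambda>y. G (monomial_point y)) \<in> poly_funs {..<d}"
    by (rule poly_funs_compose[OF F(1) monomial_point_poly_funs] poly_funs_compose[OF G(1) monomial_point_poly_funs])+
  obtain f h where f: "\<forall>t. F (monomial_point (\<lambda>i. poly (g i) t)) = poly f t"
    and h: "\<forall>t. G (monomial_point (\<lambda>i. poly (g i) t)) = poly h t"
    using poly_funs_along_curve[OF FG(1), of g] poly_funs_along_curve[OF FG(2), of g] by blast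
  have "poly f 0 \<noteq> 0" "poly h 1 \<noteq> 0"
    using spec[OF f, of 0] spec[OF h, of 1] u w by (auto simp: g_def)
  moreover have "g i \<noteq> 0" if "i < d" for i
    using u(1) that by (auto simp: g_def frozen_torus_def torus_def)
  ultimately have "f * h * (\<Prod>i<d. g i) \<noteq> 0"
    by auto
  then obtain t where t: "poly (f * h * (\<Prod>i<d. g i)) t \<noteq> 0"
    using poly_all_0_iff_0 by blast
  then have "(\<lambda>i. poly (g i) t) \<in> frozen_torus y j"
    using u(1) w(1) by (auto simp: frozen_torus_def torus_def poly_prod) (simp add: g_def)
  moreover have "F (monomial_point (\<lambda>i. poly (g i) t)) * G (monomial_point (\<lambda>i. poly (g i) t)) \<noteq> 0"
    using t f h by auto
  ultimately show ?thesis by blast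
qed

abbreviation "frozen_cone y j \<equiv> zariski_closure I (monomial_point ` frozen_torus y j)"
abbreviation "frozen_variety y j \<equiv> proj_point ` (frozen_cone y j - {0})"

lemma scaled_veronese_eq: "X = frozen_variety y (d - 1)"
  by (simp only: scaled_veronese_def scaled_veronese_torus_eq frozen_torus_top)

lemma ones_in_torus: "(\<lambda>_. 1) \<in> torus"
  by (simp add: torus_def)

lemma scaled_veronese_subset: "X \<subseteq> proj_space I"
  unfolding scaled_veronese_eq[of "\<lambda>_. 1"]
  using cone_generators_frozen[OF ones_in_torus] by (rule cone_generators.proj_cone_subset)

lemma affine_cone_scaled_veronese: "affine_cone X = zariski_closure I (monomial_point ` torus)"
  unfolding scaled_veronese_eq[of "\<lambda>_. 1"]
  using cone_generators.affine_cone_proj_cone[OF cone_generators_frozen[OF ones_in_torus], of "d - 1"]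
  by (simp only: frozen_torus_top)

lemma frozen_variety_irreducible:
  assumes "y \<in> torus"
  shows "proj_irreducible I (frozen_variety y j)"
proof (rule cone_generators.proj_irreducible_proj_cone[OF cone_generators_frozen[OF assms] frozen_torus_prime])
  have "monomial_point y \<noteq> 0"
    using monomial_point_nonzero[OF assms zero_in_veronese_exponents] by auto
  then show "monomial_point ` frozen_torus y j \<noteq> {0}"
    using frozen_torus_self[OF assms, of j] by blast
qed

lemma frozen_variety_mono: "frozen_variety y j \<subseteq> frozen_variety y (Suc j)"
  by (intro image_mono Diff_mono zariski_closure_mono frozen_torus_mono) simp

text \<open>The condition that coordinate \<open>Suc j\<close> is frozen becomes linear in
  \<open>p\<close>: it compares the coordinates at the exponents \<open>0\<close> and
  \<open>unit_exponent (Suc j)\<close>, whose quotient recovers that parameter up to the scalars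
  \<open>c\<close>.\<close>

lemma frozen_variety_strict:
  assumes y: "y \<in> torus" and j: "Suc j < d"
  shows "frozen_variety y j \<subset> frozen_variety y (Suc j)"
proof -
  let ?e = "unit_exponent (Suc j)"
  have e: "Suc j \<in> {1..<d}" using j by simp
  define F where "F p = p ?e / c ?e - y (Suc j) * (p (\<lambda>_. 0) / c (\<lambda>_. 0))" for p
  have F: "F \<in> poly_funs I"
    unfolding F_def divide_inverse
    using k e by (intro poly_funs_diff poly_funs_mult poly_funs_const poly_funs_coord
        finite_veronese_exponents zero_in_veronese_exponents unit_in_veronese_exponents)
  have F_eq: "F (monomial_point z) = z 0 * (z (Suc j) - y (Suc j))" for z
    using c_nonzero[OF zero_in_veronese_exponents] c_nonzero[OF unit_in_veronese_exponents[OF e k]]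
    by (simp add: F_def monomial_point_zero_exponent monomial_point_unit_exponent[OF e] algebra_simps)
  have "\<forall>q\<in>monomial_point ` frozen_torus y j. F q = 0"
    using j by (auto simp: F_eq frozen_torus_def)
  then have F0: "F p = 0" if "p \<in> frozen_cone y j" for p
    using zariski_closureD[OF image_affine that F] by blast
  \<comment> \<open>Doubling a nonzero coordinate changes it and keeps it nonzero, so
    \<open>z\<close> stays in the larger subtorus and violates \<open>F\<close>.\<close>
  define z where "z = y(Suc j := 2 * y (Suc j))"
  have z: "z \<in> frozen_torus y (Suc j)"
    using y by (auto simp: z_def frozen_torus_def torus_def)
  then have "monomial_point z \<in> frozen_cone y (Suc j)"
    using zariski_closure_superset by blast
  moreover have "monomial_point z \<notin> frozen_cone y j"
  proof
    assume "monomial_point z \<in> frozen_cone y j"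
    then have "z 0 * (z (Suc j) - y (Suc j)) = 0"
      using F0 F_eq by metis
    then show False
      using y d j by (auto simp: z_def torus_def)
  qed
  moreover have "affine_cone (frozen_variety y i) = frozen_cone y i" for i
    by (rule cone_generators.affine_cone_proj_cone[OF cone_generators_frozen[OF y]])
  ultimately have "frozen_variety y j \<noteq> frozen_variety y (Suc j)"
    by metis
  then show ?thesis
    using frozen_variety_mono by blast
qed

lemma proj_local_dim_torus:
  assumes y: "y \<in> torus"
  shows "proj_local_dim I X (proj_point (monomial_point y)) = enat (d - 1)"
  unfolding proj_local_dim_def
proof (rule antisym)
  let ?x = "proj_point (monomial_point y)"
  let ?D = "{enat m | m. \<exists>Z :: nat \<Rightarrow> ((nat \<Rightarrow> nat) \<Rightarrow> complex) set set.
            ?x \<in> Z 0 \<and> (\<forall>j\<le>m. proj_irreducible I (Z j) \<and> Z j \<subseteq> X) \<and>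
            (\<forall>j<m. Z j \<subset> Z (Suc j))}"
  show "Sup ?D \<le> enat (d - 1)"
  proof (rule Sup_least)
    fix e assume "e \<in> ?D"
    then obtain m and Z :: "nat \<Rightarrow> ((nat \<Rightarrow> nat) \<Rightarrow> complex) set set"
      where e: "e = enat m" and Z: "\<forall>j\<le>m. proj_irreducible I (Z j) \<and> Z j \<subseteq> X" "\<forall>j<m. Z j \<subset> Z (Suc j)"
      by blast
    have "Suc m \<le> card {..<d}"
    proof (rule irreducible_chain_length_le[where I = I and J = "{..<d}" and \<phi> = monomial_point and S = torus and Z = Z])
      show "affine_cone (Z m) \<subseteq> zariski_closure I (monomial_point ` torus)"
        using Z(1) by (auto simp: affine_cone_def simp flip: affine_cone_scaled_veronese)
    qed (use Z finite_veronese_exponents monomial_point_poly_funs image_affine in auto)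
    then show "e \<le> enat (d - 1)"
      by (simp add: e)
  qed
  have zero: "?x \<in> frozen_variety y 0"
  proof -
    have "monomial_point y \<in> frozen_cone y 0"
      using frozen_torus_self[OF y] zariski_closure_superset by blast
    moreover have "monomial_point y \<noteq> 0"
      using monomial_point_nonzero[OF y zero_in_veronese_exponents] by auto
    ultimately show ?thesis by blast
  qed
  have sub: "frozen_variety y j \<subseteq> X" for j
    unfolding scaled_veronese_eq[of y] frozen_torus_top
    by (intro image_mono Diff_mono zariski_closure_mono frozen_torus_subset) simp
  have "enat (d - 1) \<in> ?D"
  proof (rule CollectI, rule exI[of _ "d - 1"], intro conjI refl exI[of _ "frozen_variety y"] allI impI)
    fix j assume "j < d - 1"
    then show "frozen_variety y j \<subset> frozen_variety y (Suc j)"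
      by (intro frozen_variety_strict[OF y]) simp
  qed (rule zero sub frozen_variety_irreducible[OF y])+
  then show "enat (d - 1) \<le> Sup ?D"
    by (rule Sup_upper)
qed

text \<open>With \<open>s = p 0 / c 0\<close> and \<open>w i = s * y i\<close> read off at the unit
  exponents, this is \<open>s * y ^ a\<close> rewritten in terms of \<open>s\<close> and
  \<open>w\<close>, with the powers of \<open>s\<close> cleared so that both sides are polynomial.
  No other elements of the ideal are needed to describe points and tangent vectors off the
  coordinate hyperplanes.\<close>

lemma binomial_equation:
  assumes a: "a \<in> I" and p: "p \<in> zariski_closure I (monomial_point ` torus)"
  shows "p a / c a * (p (\<lambda>_. 0) / c (\<lambda>_. 0)) ^ (\<Sum>i=1..<d. a i) =
     p (\<lambda>_. 0) / c (\<lambda>_. 0) * (\<Prod>i=1..<d. (p (unit_exponent i) / c (unit_exponent i)) ^ a i)"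
proof -
  define F where "F p = p a / c a * (p (\<lambda>_. 0) / c (\<lambda>_. 0)) ^ (\<Sum>i=1..<d. a i) -
     p (\<lambda>_. 0) / c (\<lambda>_. 0) * (\<Prod>i=1..<d. (p (unit_exponent i) / c (unit_exponent i)) ^ a i)"
    for p :: "(nat \<Rightarrow> nat) \<Rightarrow> complex"
  have "F \<in> poly_funs I"
    unfolding F_def divide_inverse
    using k by (intro poly_funs_diff poly_funs_mult poly_funs_const poly_funs_coord poly_funs_prod
        poly_funs_power a finite_veronese_exponents zero_in_veronese_exponents
        unit_in_veronese_exponents)
  moreover have "F (monomial_point y) = 0" for y
  proof -
    have unit: "monomial_point y (unit_exponent i) / c (unit_exponent i) = y 0 * y i" if "i \<in> {1..<d}" for i
      using c_nonzero[OF unit_in_veronese_exponents[OF that k]]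
      by (simp add: monomial_point_unit_exponent[OF that])
    have "(\<Prod>i=1..<d. (monomial_point y (unit_exponent i) / c (unit_exponent i)) ^ a i) =
        y 0 ^ (\<Sum>i=1..<d. a i) * theta_monomial d y a"
      by (simp add: unit power_mult_distrib prod.distrib power_sum theta_monomial_def)
    then show ?thesis
      using c_nonzero[OF zero_in_veronese_exponents] c_nonzero[OF a] a
      by (simp add: F_def monomial_point_zero_exponent) (simp add: monomial_point_def)
  qed
  ultimately have "F p = 0"
    using zariski_closureD[OF image_affine p] by blast
  then show ?thesis
    by (simp add: F_def)
qed

text \<open>The coordinates at the zero and unit exponents recover the parameters. Every other
  coordinate is then determined by its binomial equation, from which the power of
  \<open>s \<noteq> 0\<close> cancels.\<close>

lemma nonzero_point_in_torus:
  assumes p: "p \<in> zariski_closure I (monomial_point ` torus)" and nz: "\<And>a. a \<in> I \<Longrightarrow> p a \<noteq> 0"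
  shows "p \<in> monomial_point ` torus"
proof -
  define s where "s = p (\<lambda>_. 0) / c (\<lambda>_. 0)"
  define w where "w i = p (unit_exponent i) / c (unit_exponent i)" for i
  define y where "y i = (if i = 0 then s else w i / s)" for i
  have s: "s \<noteq> 0"
    using nz c_nonzero zero_in_veronese_exponents by (simp add: s_def)
  have w: "w i \<noteq> 0" if "i \<in> {1..<d}" for i
    using nz c_nonzero unit_in_veronese_exponents[OF that k] by (simp add: w_def)
  have "y \<in> torus"
    using s w by (auto simp: torus_def y_def)
  moreover have "p = monomial_point y"
  proof
    fix a
    show "p a = monomial_point y a"
    proof (cases "a \<in> I")
      case True
      have "p a / c a * s ^ (\<Sum>i=1..<d. a i) = s * (\<Prod>i=1..<d. w i ^ a i)"
        unfolding s_def w_def by (rule binomial_equation[OF True p])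
      moreover have "theta_monomial d y a = (\<Prod>i=1..<d. w i ^ a i) / s ^ (\<Sum>i=1..<d. a i)"
        by (simp add: theta_monomial_def y_def power_divide prod_dividef power_sum)
      ultimately have "p a / c a * s ^ (\<Sum>i=1..<d. a i) =
          s * theta_monomial d y a * s ^ (\<Sum>i=1..<d. a i)"
        using s by simp
      then have "p a / c a = s * theta_monomial d y a"
        using s by (simp only: mult_cancel_right power_eq_0_iff) simp
      then show ?thesis
        using True c_nonzero[OF True] by (simp add: monomial_point_def y_def field_simps)
    next
      case False
      moreover have "p \<in> affine_space I"
        using p by (simp add: zariski_closure_eq[OF image_affine])
      ultimately show ?thesis
        by (simp add: monomial_point_def affine_spaceD)
    qed
  qed
  ultimately show ?thesis by blast
qed

text \<open>The logarithmic differential of the monomial parametrization.\<close>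

definition log_tangent :: "((nat \<Rightarrow> nat) \<Rightarrow> complex) \<Rightarrow> complex \<Rightarrow> (nat \<Rightarrow> complex) \<Rightarrow> (nat \<Rightarrow> nat) \<Rightarrow> complex" where
  "log_tangent p \<sigma> \<tau> = (\<lambda>a. p a * (\<sigma> + (\<Sum>i=1..<d. of_nat (a i) * \<tau> i)))"

text \<open>The vector is the velocity of the image of the curve \<open>z\<close>, which multiplies
  each parameter by a factor \<open>1 + t * \<tau> i\<close> (for the scale
  \<open>1 + t * \<sigma>\<close>) and stays in the torus for small \<open>t\<close>, where the
  whole ideal vanishes.\<close>

lemma log_tangent_in_tangent_space:
  assumes y: "y \<in> torus"
  shows "log_tangent (monomial_point y) \<sigma> \<tau> \<in> cone_tangent_space I X (monomial_point y)"
proof -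
  let ?p = "monomial_point y" and ?v = "log_tangent (monomial_point y) \<sigma> \<tau>"
  define z where "z t i = (if i = 0 then y 0 * (1 + t * \<sigma>) else y i * (1 + t * \<tau> i))" for t i
  have z0: "z 0 = y" by (auto simp: z_def)
  have deriv: "((\<lambda>t. monomial_point (z t) a) has_field_derivative ?v a) (at 0)" if "a \<in> I" for a
  proof -
    have 1: "((\<lambda>t. \<Prod>i=1..<d. z t i ^ a i) has_field_derivative
        (\<Prod>i=1..<d. z 0 i ^ a i) * (\<Sum>i=1..<d. of_nat (a i) * ((y i * \<tau> i) / z 0 i))) (at 0)"
    proof (rule has_field_derivative_monomial)
      fix i assume i: "i \<in> {1..<d}"
      then show "z 0 i \<noteq> 0" using y by (simp add: z0 torus_def)
      show "((\<lambda>t. z t i) has_field_derivative y i * \<tau> i) (at 0)"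
        unfolding z_def using i by (auto intro!: derivative_eq_intros)
    qed
    have 2: "((\<lambda>t. c a * z t 0) has_field_derivative c a * (y 0 * \<sigma>)) (at 0)"
      unfolding z_def by (auto intro!: derivative_eq_intros)
    have 3: "(\<Sum>i=1..<d. of_nat (a i) * ((y i * \<tau> i) / z 0 i)) = (\<Sum>i=1..<d. of_nat (a i) * \<tau> i)"
      using y by (intro sum.cong) (auto simp: z0 torus_def)
    show ?thesis
      using DERIV_mult[OF 2 1] that
      unfolding 3 by (simp add: z0 monomial_point_def theta_monomial_def log_tangent_def algebra_simps)
  qed
  have torus: "eventually (\<lambda>t. z t \<in> torus) (nhds 0)"
  proof -
    have "eventually (\<lambda>t. z t i \<noteq> 0) (nhds 0)" if "i < d" for i
    proof -
      have "isCont (\<lambda>t. z t i) 0"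
        unfolding z_def by (cases "i = 0") (auto intro!: continuous_intros)
      moreover have "z 0 i \<noteq> 0" using y that by (simp add: z0 torus_def)
      ultimately show ?thesis
        using tendsto_imp_eventually_ne[of "\<lambda>t. z t i" "z 0 i" "at 0" 0]
        by (simp add: isCont_def eventually_nhds_conv_at)
    qed
    then have "eventually (\<lambda>t. \<forall>i\<in>{..<d}. z t i \<noteq> 0) (nhds 0)"
      by (intro eventually_ball_finite) auto
    then show ?thesis
      by eventually_elim (auto simp: torus_def)
  qed
  have "((\<lambda>t. F (?p + cscale t ?v)) has_field_derivative 0) (at 0)"
    if F: "F \<in> vanishing_ideal I (affine_cone X)" for F
  proof -
    have F_poly: "F \<in> poly_funs I" and F_zero: "\<And>p. p \<in> monomial_point ` torus \<Longrightarrow> F p = 0"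
      using F zariski_closure_superset[of "monomial_point ` torus" I]
      by (auto simp: vanishing_ideal_def affine_cone_scaled_veronese)
    \<comment> \<open>One \<open>D\<close> serves the curve and the straight line, since both leave
      \<open>?p\<close> with velocity \<open>?v\<close>. The curve shows \<open>D = 0\<close>; the
      definition of the tangent space asks about the line.\<close>
    obtain D where D: "\<forall>\<gamma>. \<gamma> 0 = ?p \<longrightarrow> (\<forall>a\<in>I. ((\<lambda>t. \<gamma> t a) has_field_derivative ?v a) (at 0))
        \<longrightarrow> ((\<lambda>t. F (\<gamma> t)) has_field_derivative D) (at 0)"
      using poly_funs_has_derivative[OF F_poly] by (rule exE)
    have "((\<lambda>t. F (monomial_point (z t))) has_field_derivative D) (at 0)"
      using D[rule_format, of "\<lambda>t. monomial_point (z t)"] deriv by (simp add: z0)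
    moreover have "((\<lambda>t. F (monomial_point (z t))) has_field_derivative 0) (at 0)"
    proof (subst DERIV_cong_ev[OF refl _ refl])
      show "eventually (\<lambda>t. F (monomial_point (z t)) = 0) (nhds 0)"
        using torus by eventually_elim (use F_zero in blast)
    qed simp
    ultimately have "D = 0"
      by (rule DERIV_unique)
    moreover have "((\<lambda>t. F (?p + cscale t ?v)) has_field_derivative D) (at 0)"
    proof (rule D[rule_format, of "\<lambda>t. ?p + cscale t ?v"])
      show "((\<lambda>t. (?p + cscale t ?v) a) has_field_derivative ?v a) (at 0)" for a
        by (auto simp: cscale_apply intro!: derivative_eq_intros)
    qed (simp add: cscale_def fun_eq_iff)
    ultimately show ?thesis by simp
  qed
  moreover have "?v \<in> affine_space I"
    using monomial_point_affine[of y] by (simp add: affine_space_def log_tangent_def)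
  ultimately show ?thesis
    by (simp add: cone_tangent_space_def)
qed

text \<open>Put \<open>l a = v a / p a\<close>. The logarithmic derivative of the binomial equation
  along \<open>v\<close> reads
  \<open>l a + N * l 0 = l 0 + \<Sum>i. a i * l (unit_exponent i)\<close> with \<open>N\<close> the
  degree of \<open>a\<close>. Hence \<open>l\<close> is affine in \<open>a\<close>, with
  \<open>\<sigma> = l 0\<close> and \<open>\<tau> i = l (unit_exponent i) - l 0\<close>.\<close>

lemma tangent_space_log_tangent:
  assumes y: "y \<in> torus" and v: "v \<in> cone_tangent_space I X (monomial_point y)"
  shows "\<exists>\<sigma> \<tau>. v = log_tangent (monomial_point y) \<sigma> \<tau>"
proof -
  let ?p = "monomial_point y"
  define o' :: "nat \<Rightarrow> nat" where "o' = (\<lambda>_. 0)"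
  define l where "l a = v a / ?p a" for a
  have o': "o' \<in> I" by (simp add: o'_def zero_in_veronese_exponents)
  have aff: "v \<in> affine_space I"
    using v by (simp add: cone_tangent_space_def)
  have l: "l a = l o' + (\<Sum>i=1..<d. of_nat (a i) * (l (unit_exponent i) - l o'))" if a: "a \<in> I" for a
  proof -
    define g where "g b t = (?p b + t * v b) / c b" for b t
    have "(g b has_field_derivative v b / c b) (at 0)" if "b \<in> I" for b
      unfolding g_def[abs_def] using c_nonzero[OF that] by (auto intro!: derivative_eq_intros)
    moreover have "g b 0 \<noteq> 0" "(v b / c b) / g b 0 = l b" if "b \<in> I" for b
      using c_nonzero[OF that] monomial_point_nonzero[OF y that] by (auto simp: g_def l_def)
    ultimately have g: "(g b has_field_derivative v b / c b) (at 0)" "g b 0 \<noteq> 0" "(v b / c b) / g b 0 = l b"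
      if "b \<in> I" for b
      using that by blast+
    have units: "unit_exponent i \<in> I" if "i \<in> {1..<d}" for i
      using unit_in_veronese_exponents[OF that k] .
    define N where "N = (\<Sum>i=1..<d. a i)"
    \<comment> \<open>\<open>A\<close> and \<open>B\<close> are the two sides of the binomial
      equation along the line \<open>p + t v\<close>. They agree and are nonzero at
      \<open>t = 0\<close>, so equal derivatives give equal logarithmic derivatives.\<close>
    define A where "A t = g a t * g o' t ^ N" for t
    define B where "B t = g o' t * (\<Prod>i=1..<d. g (unit_exponent i) t ^ a i)" for t
    have A: "(A has_field_derivative A 0 * (l a + of_nat N * l o')) (at 0)"
    proof -
      have "(A has_field_derivative v a / c a * g o' 0 ^ N + of_nat N * (v o' / c o' * g o' 0 ^ (N - 1)) * g a 0) (at 0)"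
        unfolding A_def by (auto intro!: derivative_eq_intros g a o')
      also have "v a / c a * g o' 0 ^ N + of_nat N * (v o' / c o' * g o' 0 ^ (N - 1)) * g a 0 =
          A 0 * ((v a / c a) / g a 0 + of_nat N * ((v o' / c o') / g o' 0))"
      proof -
        have "x * w ^ N + of_nat N * (r * w ^ (N - 1)) * z = z * w ^ N * (x / z + of_nat N * (r / w))"
          if "z \<noteq> 0" "w \<noteq> 0" for x r z w :: complex
          using that by (cases N) (simp_all add: field_simps)
        from this[OF g(2)[OF a] g(2)[OF o']] show ?thesis
          unfolding A_def .
      qed
      finally show ?thesis
        unfolding g(3)[OF a] g(3)[OF o'] .
    qed
    have B: "(B has_field_derivative B 0 * (l o' + (\<Sum>i=1..<d. of_nat (a i) * l (unit_exponent i)))) (at 0)"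
    proof -
      have "((\<lambda>t. \<Prod>i=1..<d. g (unit_exponent i) t ^ a i) has_field_derivative
         (\<Prod>i=1..<d. g (unit_exponent i) 0 ^ a i) *
         (\<Sum>i=1..<d. of_nat (a i) * ((v (unit_exponent i) / c (unit_exponent i)) / g (unit_exponent i) 0))) (at 0)"
        by (rule has_field_derivative_monomial) (use g units in auto)
      from DERIV_mult[OF g(1)[OF o'] this]
      have "(B has_field_derivative
         v o' / c o' * (\<Prod>i=1..<d. g (unit_exponent i) 0 ^ a i) +
         (\<Prod>i=1..<d. g (unit_exponent i) 0 ^ a i) *
         (\<Sum>i=1..<d. of_nat (a i) * ((v (unit_exponent i) / c (unit_exponent i)) / g (unit_exponent i) 0)) * g o' 0) (at 0)"
        unfolding B_def .
      also have "(\<Sum>i=1..<d. of_nat (a i) * ((v (unit_exponent i) / c (unit_exponent i)) / g (unit_exponent i) 0)) =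
          (\<Sum>i=1..<d. of_nat (a i) * l (unit_exponent i))"
        using g(3)[OF units] by (intro sum.cong) auto
      also have "v o' / c o' * (\<Prod>i=1..<d. g (unit_exponent i) 0 ^ a i) +
         (\<Prod>i=1..<d. g (unit_exponent i) 0 ^ a i) * (\<Sum>i=1..<d. of_nat (a i) * l (unit_exponent i)) * g o' 0 =
         B 0 * ((v o' / c o') / g o' 0 + (\<Sum>i=1..<d. of_nat (a i) * l (unit_exponent i)))"
        using g(2)[OF o'] by (simp add: B_def field_simps)
      finally show ?thesis
        unfolding g(3)[OF o'] .
    qed
    define F where "F p = p a / c a * (p o' / c o') ^ N -
       p o' / c o' * (\<Prod>i=1..<d. (p (unit_exponent i) / c (unit_exponent i)) ^ a i)"
      for p :: "(nat \<Rightarrow> nat) \<Rightarrow> complex"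
    have "F \<in> poly_funs I"
      unfolding F_def divide_inverse
      by (intro poly_funs_diff poly_funs_mult poly_funs_const poly_funs_coord poly_funs_prod
          poly_funs_power a finite_veronese_exponents o' units)
    moreover have F0: "F p = 0" if "p \<in> affine_cone X" for p
      using binomial_equation[OF a, of p] that
      by (simp add: F_def N_def o'_def affine_cone_scaled_veronese)
    ultimately have "F \<in> vanishing_ideal I (affine_cone X)"
      by (simp add: vanishing_ideal_def)
    then have "((\<lambda>t. F (?p + cscale t v)) has_field_derivative 0) (at 0)"
      using v by (simp add: cone_tangent_space_def)
    moreover have "F (?p + cscale t v) = A t - B t" for t
      by (simp add: F_def A_def B_def g_def cscale_apply)
    ultimately have "((\<lambda>t. A t - B t) has_field_derivative 0) (at 0)"
      by simp
    from DERIV_unique[OF this DERIV_diff[OF A B]]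
    have "A 0 * (l a + of_nat N * l o') = B 0 * (l o' + (\<Sum>i=1..<d. of_nat (a i) * l (unit_exponent i)))"
      by simp
    moreover have "A 0 = B 0"
    proof -
      have "?p \<in> affine_cone X"
        unfolding affine_cone_scaled_veronese using y zariski_closure_superset by blast
      then have "F ?p = 0" by (rule F0)
      then show ?thesis by (simp add: F_def A_def B_def g_def)
    qed
    moreover have "A 0 \<noteq> 0"
      using g(2)[OF a] g(2)[OF o'] by (simp add: A_def)
    ultimately have "l a + of_nat N * l o' = l o' + (\<Sum>i=1..<d. of_nat (a i) * l (unit_exponent i))"
      by simp
    then show ?thesis
      by (simp add: N_def right_diff_distrib sum_subtractf sum_distrib_left algebra_simps)
  qed
  have "v = log_tangent ?p (l o') (\<lambda>i. l (unit_exponent i) - l o')"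
  proof
    fix a
    show "v a = log_tangent ?p (l o') (\<lambda>i. l (unit_exponent i) - l o') a"
    proof (cases "a \<in> I")
      case True
      then have "v a = ?p a * l a"
        using monomial_point_nonzero[OF y True] by (simp add: l_def)
      then show ?thesis
        using l[OF True] by (simp add: log_tangent_def)
    qed (simp add: affine_spaceD[OF aff] log_tangent_def monomial_point_def)
  qed
  then show ?thesis by blast
qed

lemma tangent_space_eq:
  assumes y: "y \<in> torus"
  shows "cone_tangent_space I X (monomial_point y) = {log_tangent (monomial_point y) \<sigma> \<tau> | \<sigma> \<tau>. True}"
  using tangent_space_log_tangent[OF y] log_tangent_in_tangent_space[OF y] by auto

text \<open>The basis consists of the radial vector \<open>p\<close> and, for each parameter
  \<open>j\<close>, the vector with entries \<open>p a * a j\<close>. Evaluating a linear relation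
  at the exponent \<open>0\<close> removes the radial coefficient, and evaluating at the unit
  exponents removes the others.\<close>

lemma dim_tangent_space:
  assumes y: "y \<in> torus"
  shows "cfun.dim (cone_tangent_space I X (monomial_point y)) = d"
proof -
  let ?p = "monomial_point y" and ?T = "cone_tangent_space I X (monomial_point y)"
  define b where "b j = (if j = 0 then ?p else (\<lambda>a. ?p a * of_nat (a j)))" for j
  have p0: "?p (\<lambda>_. 0) \<noteq> 0"
    by (rule monomial_point_nonzero[OF y zero_in_veronese_exponents])
  have pu: "?p (unit_exponent i) \<noteq> 0" if "i \<in> {1..<d}" for i
    by (rule monomial_point_nonzero[OF y unit_in_veronese_exponents[OF that k]])
  have split: "{..<d} = insert 0 {1..<d}"
    using d by auto
  have expand: "(\<Sum>j<d. cscale (s j) (b j)) = log_tangent ?p (s 0) s" for s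
    unfolding split log_tangent_def
    by (auto simp: fun_eq_iff sum_fun_apply cscale_apply b_def algebra_simps sum_distrib_left intro!: sum.cong)
  have indep0: "s j = 0" if "(\<Sum>j<d. cscale (s j) (b j)) = 0" "j < d" for s j
  proof -
    have zero: "log_tangent ?p (s 0) s a = 0" for a
      using that(1) by (simp add: expand)
    have s0: "s 0 = 0"
      using zero[of "\<lambda>_. 0"] p0 by (simp add: log_tangent_def)
    show ?thesis
    proof (cases "j = 0")
      case False
      then have j: "j \<in> {1..<d}" using that by simp
      have "(\<Sum>i=1..<d. of_nat (unit_exponent j i) * s i) = s j"
        using j by (simp add: unit_exponent_def if_distrib[of of_nat] if_distrib[of "\<lambda>x. x * _"] cong: if_cong)
      then show ?thesis
        using zero[of "unit_exponent j"] pu[OF j] s0 by (simp add: log_tangent_def)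
    qed (simp add: s0)
  qed
  have inj: "inj_on b {..<d}"
  proof (rule inj_onI, rule ccontr)
    fix i j assume ij: "i \<in> {..<d}" "j \<in> {..<d}" "b i = b j" "i \<noteq> j"
    define s :: "nat \<Rightarrow> complex" where "s = (\<lambda>m. if m = i then 1 else if m = j then - 1 else 0)"
    have "(\<Sum>m<d. cscale (s m) (b m)) = (\<Sum>m\<in>{i, j}. cscale (s m) (b m))"
      using ij by (intro sum.mono_neutral_right) (auto simp: s_def cscale_eq_0_iff)
    also have "\<dots> = 0"
      using ij by (simp add: s_def cscale_def fun_eq_iff)
    finally have "s i = 0"
      using indep0 ij by blast
    then show False by (simp add: s_def)
  qed
  have indep: "cfun.independent (b ` {..<d})"
  proof (rule cfun.independent_if_scalars_zero)
    fix f x assume "(\<Sum>x\<in>b ` {..<d}. cscale (f x) x) = 0" "x \<in> b ` {..<d}"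
    then show "f x = 0"
      using indep0[of "\<lambda>j. f (b j)"] by (auto simp: sum.reindex[OF inj])
  qed simp
  have "cfun.span (b ` {..<d}) = ?T"
  proof
    have "v \<in> cfun.span (b ` {..<d})" if "v \<in> ?T" for v
    proof -
      obtain \<sigma> \<tau> where "v = log_tangent ?p \<sigma> \<tau>"
        using tangent_space_log_tangent[OF y \<open>v \<in> ?T\<close>] by blast
      \<comment> \<open>\<open>log_tangent\<close> never reads \<open>\<tau> 0\<close>, so that slot
        can carry \<open>\<sigma>\<close> and a single coefficient function suffices.\<close>
      also have "\<dots> = log_tangent ?p ((\<tau>(0 := \<sigma>)) 0) (\<tau>(0 := \<sigma>))"
        by (auto simp: log_tangent_def fun_eq_iff)
      also have "\<dots> = (\<Sum>j<d. cscale ((\<tau>(0 := \<sigma>)) j) (b j))"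
        by (rule expand[symmetric])
      also have "\<dots> \<in> cfun.span (b ` {..<d})"
        by (intro cfun.span_sum cfun.span_scale cfun.span_base) auto
      finally show ?thesis .
    qed
    then show "?T \<subseteq> cfun.span (b ` {..<d})" by blast
    show "cfun.span (b ` {..<d}) \<subseteq> ?T"
    proof
      fix v assume "v \<in> cfun.span (b ` {..<d})"
      then obtain u where "v = (\<Sum>w\<in>b ` {..<d}. cscale (u w) w)"
        by (auto simp: cfun.span_finite)
      then have "v = log_tangent ?p (u (b 0)) (\<lambda>j. u (b j))"
        using expand[of "\<lambda>j. u (b j)"] by (simp add: sum.reindex[OF inj])
      then show "v \<in> ?T"
        using log_tangent_in_tangent_space[OF y] by simp
    qed
  qed
  then have "cfun.dim ?T = cfun.dim (b ` {..<d})"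
    by (metis cfun.dim_span)
  then show ?thesis
    using cfun.dim_eq_card_independent[OF indep] by (simp add: card_image[OF inj])
qed

section \<open>Smoothness of the torus points\<close>

lemma torus_representatives:
  assumes "y \<in> torus" "p \<in> proj_point (monomial_point y)"
  shows "p \<in> monomial_point ` torus"
proof -
  obtain t where t: "t \<noteq> 0" "p = cscale t (monomial_point y)"
    using assms by (auto simp: proj_point_def)
  have "y(0 := t * y 0) \<in> torus"
    using assms(1) t d by (auto simp: torus_def)
  then show ?thesis
    unfolding t cscale_monomial_point by blast
qed

lemma torus_point_in_variety:
  assumes "y \<in> torus"
  shows "proj_point (monomial_point y) \<in> X"
proof -
  have "monomial_point y \<in> affine_cone X"
    unfolding affine_cone_scaled_veronese using assms zariski_closure_superset by blast
  moreover have "monomial_point y \<noteq> 0"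
    using monomial_point_nonzero[OF assms zero_in_veronese_exponents] by auto
  ultimately show ?thesis
    using proj_point_mem_iff[OF scaled_veronese_subset] by blast
qed

lemma torus_point_smooth:
  assumes y: "y \<in> torus"
  shows "proj_point (monomial_point y) \<in> smooth_points I X"
proof -
  have "enat (cfun.dim (cone_tangent_space I X p)) =
      proj_local_dim I X (proj_point (monomial_point y)) + 1"
    if p: "p \<in> proj_point (monomial_point y)" for p
  proof -
    obtain z where "z \<in> torus" "p = monomial_point z"
      using torus_representatives[OF y p] by blast
    then show ?thesis
      using d by (simp add: dim_tangent_space proj_local_dim_torus[OF y] one_enat_def)
  qed
  then show ?thesis
    using torus_point_in_variety[OF y] by (simp add: smooth_points_def)
qed

end

subsection \<open>The likelihood equations\<close>

text \<open>Two nonempty Zariski open sets meet, again by a line through one point of each. This is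
  what makes the number in \<open>mldeg\<close> unique: two generic counts can be compared at a
  common \<open>u\<close>.\<close>

lemma generically_conj_witness:
  assumes "finite I" "generically I P" "generically I Q"
  shows "\<exists>u\<in>affine_space I. P u \<and> Q u"
proof -
  have *: "\<exists>u F. u \<in> affine_space I \<and> F \<in> poly_funs I \<and> F u \<noteq> 0 \<and> (\<forall>w\<in>affine_space I. F w \<noteq> 0 \<longrightarrow> R w)"
    if R: "generically I R" for R
  proof -
    obtain Z where Z: "zariski_closed I Z" "Z \<noteq> affine_space I" "\<forall>u\<in>affine_space I - Z. R u"
      using R unfolding generically_def by blast
    have "Z \<subseteq> affine_space I"
      using Z(1) by (auto simp: zariski_closed_def)
    then obtain u where u: "u \<in> affine_space I" "u \<notin> Z"
      using Z(2) by blast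
    obtain F where F: "F \<in> poly_funs I" "\<forall>q\<in>Z. F q = 0" "F u \<noteq> 0"
      using zariski_closed_separate[OF Z(1) u] by blast
    have "R w" if "w \<in> affine_space I" "F w \<noteq> 0" for w
      using Z(3) F(2) that by blast
    then show ?thesis
      using u F by blast
  qed
  obtain u F where F: "u \<in> affine_space I" "F \<in> poly_funs I" "F u \<noteq> 0"
      "\<forall>w\<in>affine_space I. F w \<noteq> 0 \<longrightarrow> P w"
    using *[OF assms(2)] by blast
  obtain w G where G: "w \<in> affine_space I" "G \<in> poly_funs I" "G w \<noteq> 0"
      "\<forall>w\<in>affine_space I. G w \<noteq> 0 \<longrightarrow> Q w"
    using *[OF assms(3)] by blast
  define g where "g i = [:u i, w i - u i:]" for i
  obtain f where f: "\<forall>t. F (\<lambda>i. poly (g i) t) = poly f t"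
    using poly_funs_along_curve[OF F(2), of g] by (rule exE)
  obtain h where h: "\<forall>t. G (\<lambda>i. poly (g i) t) = poly h t"
    using poly_funs_along_curve[OF G(2), of g] by (rule exE)
  have "poly f 0 \<noteq> 0" "poly h 1 \<noteq> 0"
    using spec[OF f, of 0] spec[OF h, of 1] F(3) G(3) by (simp_all add: g_def)
  then have "f * h \<noteq> 0" by auto
  then obtain t where t: "poly (f * h) t \<noteq> 0"
    using poly_all_0_iff_0 by blast
  define q where "q = (\<lambda>i. poly (g i) t)"
  have "q \<in> affine_space I"
    using F(1) G(1) by (auto simp: q_def affine_space_def g_def)
  moreover have "F q \<noteq> 0" "G q \<noteq> 0"
    using t spec[OF f, of t] spec[OF h, of t] by (simp_all add: q_def)
  ultimately show ?thesis
    using F(4) G(4) by blast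
qed

lemma mldeg_eqI:
  assumes "finite I"
    and gen: "generically I (\<lambda>u. finite (likelihood_critical_points I X u) \<and>
      card (likelihood_critical_points I X u) = m)"
  shows "mldeg I X = m"
  unfolding mldeg_def
proof (rule the_equality[where P = "\<lambda>m. generically I (\<lambda>u. finite (likelihood_critical_points I X u) \<and>
      card (likelihood_critical_points I X u) = m)", OF gen])
  fix n
  assume "generically I (\<lambda>u. finite (likelihood_critical_points I X u) \<and>
      card (likelihood_critical_points I X u) = n)"
  from generically_conj_witness[OF assms(1) gen this] show "n = m"
    by auto
qed

text \<open>At \<open>t = 0\<close> every base of \<open>powr\<close> equals \<open>1\<close>, so
  the principal branch is differentiable there and every factor has value \<open>1\<close>; the
  derivative therefore coincides with the logarithmic derivative.\<close>

lemma has_field_derivative_likelihood_branch: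
  assumes "finite I" and p: "\<And>i. i \<in> I \<Longrightarrow> p i \<noteq> 0" "(\<Sum>i\<in>I. p i) \<noteq> 0"
  shows "((\<lambda>t. likelihood_branch I u p (p + cscale t v)) has_field_derivative
     (\<Sum>i\<in>I. u i * (v i / p i)) - (\<Sum>i\<in>I. u i) * ((\<Sum>i\<in>I. v i) / (\<Sum>i\<in>I. p i))) (at 0)"
proof -
  have pow: "((\<lambda>t. ((r + t * w) / r) powr e) has_field_derivative e * (w / r)) (at 0)"
    if "r \<noteq> 0" for r w e :: complex
  proof -
    have "((\<lambda>t. (r + t * w) / r) has_field_derivative w / r) (at 0)"
      using that by (auto intro!: derivative_eq_intros)
    moreover have "((\<lambda>z. z powr e) has_field_derivative e * 1 powr (e - 1)) (at ((r + 0 * w) / r))"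
      using that has_field_derivative_powr[of 1 e] by simp
    ultimately show ?thesis
      using DERIV_chain2[of "\<lambda>z. z powr e" _ "\<lambda>t. (r + t * w) / r" 0 "w / r" UNIV] by simp
  qed
  have num: "((\<lambda>t. \<Prod>i\<in>I. ((p i + t * v i) / p i) powr u i) has_field_derivative
      (\<Prod>i\<in>I. ((p i + 0 * v i) / p i) powr u i) *
      (\<Sum>i\<in>I. (u i * (v i / p i)) / (((p i + 0 * v i) / p i) powr u i))) (at 0)"
    by (rule has_field_derivative_prod') (use p pow in auto)
  have num': "((\<lambda>t. \<Prod>i\<in>I. ((p i + t * v i) / p i) powr u i) has_field_derivative
      (\<Sum>i\<in>I. u i * (v i / p i))) (at 0)"
    using num p by simp
  note den = pow[OF p(2), of "\<Sum>i\<in>I. v i" "\<Sum>i\<in>I. u i"]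
  have "((\<lambda>t. (\<Prod>i\<in>I. ((p i + t * v i) / p i) powr u i) /
      (((\<Sum>i\<in>I. p i) + t * (\<Sum>i\<in>I. v i)) / (\<Sum>i\<in>I. p i)) powr (\<Sum>i\<in>I. u i)) has_field_derivative
      (\<Sum>i\<in>I. u i * (v i / p i)) - (\<Sum>i\<in>I. u i) * ((\<Sum>i\<in>I. v i) / (\<Sum>i\<in>I. p i))) (at 0)"
    using DERIV_divide[OF num' den] p by simp
  moreover have "likelihood_branch I u p (p + cscale t v) = (\<Prod>i\<in>I. ((p i + t * v i) / p i) powr u i) /
      (((\<Sum>i\<in>I. p i) + t * (\<Sum>i\<in>I. v i)) / (\<Sum>i\<in>I. p i)) powr (\<Sum>i\<in>I. u i)" for t
    by (simp add: likelihood_branch_def cscale_apply sum.distrib sum_distrib_left)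
  ultimately show ?thesis
    by simp
qed

lemma theta_monomial_update:
  assumes "i \<in> {1..<d}"
  shows "theta_monomial d (\<theta>(i := \<theta> i * s)) a = theta_monomial d \<theta> a * s ^ a i"
proof -
  have "(\<Prod>j\<in>{1..<d} - {i}. (\<theta>(i := \<theta> i * s)) j ^ a j) = (\<Prod>j\<in>{1..<d} - {i}. \<theta> j ^ a j)"
    by (intro prod.cong) auto
  moreover have split: "(\<Prod>j=1..<d. f j) = f i * (\<Prod>j\<in>{1..<d} - {i}. f j)" for f :: "nat \<Rightarrow> complex"
    using assms by (intro prod.remove) auto
  ultimately show ?thesis
    unfolding theta_monomial_def split by (simp only: fun_upd_same power_mult_distrib mult_ac)
qed

section \<open>Likelihood equations for a power of a linear form\<close>

locale power_of_linear_form = scaled_monomials +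
  fixes b :: "nat \<Rightarrow> complex"
  assumes power: "\<And>\<theta>. scaling_poly d k c \<theta> = (b 0 + (\<Sum>i=1..<d. b i * \<theta> i)) ^ k"
begin

definition linear_form :: "(nat \<Rightarrow> complex) \<Rightarrow> complex" where
  "linear_form y = b 0 + (\<Sum>i=1..<d. b i * y i)"

lemma linear_form_update:
  assumes "i \<in> {1..<d}"
  shows "linear_form (y(i := r)) = linear_form y + b i * (r - y i)"
proof -
  have "(\<Sum>j\<in>{1..<d} - {i}. b j * (y(i := r)) j) = (\<Sum>j\<in>{1..<d} - {i}. b j * y j)"
    by (intro sum.cong) auto
  moreover have split: "(\<Sum>j=1..<d. f j) = f i + (\<Sum>j\<in>{1..<d} - {i}. f j)" for f :: "nat \<Rightarrow> complex"
    using assms by (intro sum.remove) auto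
  ultimately show ?thesis
    unfolding linear_form_def split by (simp only: fun_upd_same algebra_simps)
qed

lemma scaling_poly_eq: "scaling_poly d k c y = linear_form y ^ k"
  by (simp add: power linear_form_def)

lemma sum_monomial_point: "(\<Sum>a\<in>I. monomial_point y a) = y 0 * linear_form y ^ k"
  unfolding scaling_poly_eq[symmetric]
  by (simp add: monomial_point_def scaling_poly_def sum_distrib_left mult_ac)

text \<open>Perturbing \<open>y i\<close> multiplicatively, to \<open>y i * (1 + t)\<close>, makes
  the ordinary derivative at \<open>t = 0\<close> the Euler operator. It is computed once on the
  monomials and once on the power of the linear form.\<close>

lemma weighted_sum_monomial_point:
  assumes i: "i \<in> {1..<d}"
  shows "(\<Sum>a\<in>I. of_nat (a i) * monomial_point y a) =
     y 0 * (of_nat k * b i * y i * linear_form y ^ (k - 1))"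
proof -
  have 1: "((\<lambda>t. scaling_poly d k c (y(i := y i * (1 + t)))) has_field_derivative
      (\<Sum>a\<in>I. c a * (theta_monomial d y a * of_nat (a i)))) (at 0)"
    unfolding scaling_poly_def theta_monomial_update[OF i]
    by (intro DERIV_sum) (auto intro!: derivative_eq_intros)
  have "((\<lambda>t. (linear_form y + b i * (y i * (1 + t) - y i)) ^ k) has_field_derivative
      of_nat k * (b i * y i) * linear_form y ^ (k - 1)) (at 0)"
    by (auto intro!: derivative_eq_intros)
  then have 2: "((\<lambda>t. scaling_poly d k c (y(i := y i * (1 + t)))) has_field_derivative
      of_nat k * (b i * y i) * linear_form y ^ (k - 1)) (at 0)"
    unfolding scaling_poly_eq linear_form_update[OF i] .
  have "(\<Sum>a\<in>I. of_nat (a i) * monomial_point y a) =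
      y 0 * (\<Sum>a\<in>I. c a * (theta_monomial d y a * of_nat (a i)))"
    by (simp add: monomial_point_def sum_distrib_left mult_ac)
  then show ?thesis
    using DERIV_unique[OF 1 2] by (simp add: mult_ac)
qed

lemma theta_monomial_at_zero:
  assumes "a \<in> I"
  shows "theta_monomial d (\<lambda>_. 0) a = (if a = (\<lambda>_. 0) then 1 else 0)"
proof (cases "a = (\<lambda>_. 0)")
  case False
  then obtain j where "a j \<noteq> 0" by (auto simp: fun_eq_iff)
  moreover from this have "j \<in> {1..<d}"
    using assms by (auto simp: veronese_exponents_def)
  ultimately show ?thesis
    using False by (auto simp: theta_monomial_def intro!: prod_zero)
qed (simp add: theta_monomial_zero)

lemma constant_coefficient_nonzero: "b 0 \<noteq> 0"
proof -
  have "scaling_poly d k c (\<lambda>_. 0) = (\<Sum>a\<in>I. if a = (\<lambda>_. 0) then c a else 0)"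
    unfolding scaling_poly_def by (intro sum.cong) (auto simp: theta_monomial_at_zero)
  also have "\<dots> = c (\<lambda>_. 0)"
    by (simp add: finite_veronese_exponents zero_in_veronese_exponents)
  finally have "b 0 ^ k = c (\<lambda>_. 0)"
    by (simp add: power)
  then show ?thesis
    using c_nonzero[OF zero_in_veronese_exponents] k by (auto simp: power_0_left)
qed

text \<open>If \<open>b i = 0\<close>, the polynomial is constant along the \<open>i\<close>-th
  axis, yet its derivative there at the origin is the nonzero coefficient
  \<open>c (unit_exponent i)\<close>.\<close>

lemma linear_coefficient_nonzero:
  assumes i: "i \<in> {1..<d}"
  shows "b i \<noteq> 0"
proof
  assume "b i = 0"
  define y :: "complex \<Rightarrow> nat \<Rightarrow> complex" where "y t = (\<lambda>_. 0)(i := t)" for t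
  have "((\<lambda>t. theta_monomial d (y t) a) has_field_derivative (if a = unit_exponent i then 1 else 0)) (at 0)"
    if a: "a \<in> I" for a
  proof (cases "\<exists>j\<in>{1..<d} - {i}. a j \<noteq> 0")
    case True
    then obtain j where j: "j \<in> {1..<d} - {i}" "a j \<noteq> 0" by blast
    then have "theta_monomial d (y t) a = 0" for t
      by (auto simp: theta_monomial_def y_def intro!: prod_zero)
    moreover have "a \<noteq> unit_exponent i"
      using j by (auto simp: unit_exponent_def)
    ultimately show ?thesis by simp
  next
    case False
    then have a0: "a j = 0" if "j \<noteq> i" for j
      using a that by (cases "j \<in> {1..<d}") (auto simp: veronese_exponents_def)
    have "(\<Prod>j\<in>{1..<d} - {i}. y t j ^ a j) = 1" for t
      by (intro prod.neutral) (auto simp: a0)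
    then have "theta_monomial d (y t) a = t ^ a i" for t
      using prod.remove[of "{1..<d}" i "\<lambda>j. y t j ^ a j"] i
      by (simp only: theta_monomial_def mult_1_right finite_atLeastLessThan) (simp add: y_def)
    moreover have "a = unit_exponent i \<longleftrightarrow> a i = 1"
      using a0 by (auto simp: unit_exponent_def fun_eq_iff)
    moreover have "((\<lambda>t::complex. t ^ n) has_field_derivative (if n = 1 then 1 else 0)) (at 0)" for n :: nat
      by (cases n) (auto intro!: derivative_eq_intros)
    ultimately show ?thesis by simp
  qed
  then have "((\<lambda>t. scaling_poly d k c (y t)) has_field_derivative
      (\<Sum>a\<in>I. c a * (if a = unit_exponent i then 1 else 0))) (at 0)"
    unfolding scaling_poly_def by (intro DERIV_sum DERIV_cmult) auto
  moreover have "(\<Sum>a\<in>I. c a * (if a = unit_exponent i then 1 else 0)) = c (unit_exponent i)"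
    using unit_in_veronese_exponents[OF i k] by (simp add: finite_veronese_exponents if_distrib cong: if_cong)
  moreover have "scaling_poly d k c (y t) = b 0 ^ k" for t
  proof -
    have "(\<Sum>j=1..<d. b j * y t j) = 0"
      using \<open>b i = 0\<close> by (intro sum.neutral) (simp add: y_def)
    then show ?thesis by (simp only: power add_0_right)
  qed
  ultimately have "((\<lambda>t. b 0 ^ k) has_field_derivative c (unit_exponent i)) (at 0)"
    by simp
  then have "c (unit_exponent i) = 0"
    using DERIV_unique[OF _ DERIV_const] by blast
  then show False
    using c_nonzero[OF unit_in_veronese_exponents[OF i k]] by simp
qed

definition total_weight :: "((nat \<Rightarrow> nat) \<Rightarrow> complex) \<Rightarrow> complex" where
  "total_weight u = (\<Sum>a\<in>I. u a)"

text \<open>The \<open>i\<close>-th entry of \<open>A u\<close>, a sufficient statistic of the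
  log-linear model.\<close>

definition moment :: "((nat \<Rightarrow> nat) \<Rightarrow> complex) \<Rightarrow> nat \<Rightarrow> complex" where
  "moment u i = (\<Sum>a\<in>I. u a * of_nat (a i))"

text \<open>The derivative along \<open>log_tangent\<close> is linear in \<open>\<tau>\<close> with
  coefficients \<open>D i\<close>. The part in \<open>\<sigma>\<close> cancels because the
  likelihood function is homogeneous of degree zero. Since \<open>\<tau>\<close> is arbitrary,
  criticality means that every \<open>D i\<close> is zero.\<close>

lemma likelihood_equations:
  assumes y: "y \<in> torus" and L: "linear_form y \<noteq> 0"
  shows "(\<forall>v\<in>cone_tangent_space I X (monomial_point y).
       ((\<lambda>t. likelihood_branch I u (monomial_point y) (monomial_point y + cscale t v)) has_field_derivative 0) (at 0))
     \<longleftrightarrow> (\<forall>i\<in>{1..<d}. moment u i * linear_form y = of_nat k * total_weight u * b i * y i)"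
    (is "?crit \<longleftrightarrow> ?eqs")
proof -
  let ?p = "monomial_point y"
  have y0: "y 0 \<noteq> 0" using y d by (auto simp: torus_def)
  have p: "?p a \<noteq> 0" if "a \<in> I" for a
    by (rule monomial_point_nonzero[OF y that])
  have sp: "(\<Sum>a\<in>I. ?p a) \<noteq> 0"
    using y0 L by (simp add: sum_monomial_point)
  define D where "D i = moment u i - of_nat k * total_weight u * b i * y i / linear_form y" for i
  have D: "(\<Sum>a\<in>I. u a * (log_tangent ?p \<sigma> \<tau> a / ?p a)) -
      (\<Sum>a\<in>I. u a) * ((\<Sum>a\<in>I. log_tangent ?p \<sigma> \<tau> a) / (\<Sum>a\<in>I. ?p a)) = (\<Sum>i=1..<d. \<tau> i * D i)" for \<sigma> \<tau>
  proof -
    have "(\<Sum>a\<in>I. u a * (log_tangent ?p \<sigma> \<tau> a / ?p a)) =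
        (\<Sum>a\<in>I. u a * \<sigma> + (\<Sum>i=1..<d. \<tau> i * (u a * of_nat (a i))))"
    proof (rule sum.cong)
      fix a assume "a \<in> I"
      then have "log_tangent ?p \<sigma> \<tau> a / ?p a = \<sigma> + (\<Sum>i=1..<d. of_nat (a i) * \<tau> i)"
        using p by (simp add: log_tangent_def)
      then show "u a * (log_tangent ?p \<sigma> \<tau> a / ?p a) =
          u a * \<sigma> + (\<Sum>i=1..<d. \<tau> i * (u a * of_nat (a i)))"
        by (simp only: distrib_left sum_distrib_left mult_ac)
    qed simp
    also have "\<dots> = total_weight u * \<sigma> + (\<Sum>i=1..<d. \<tau> i * moment u i)"
      by (simp add: sum.distrib total_weight_def moment_def sum_distrib_left sum_distrib_right sum.swap[of _ I])
    finally have 1: "(\<Sum>a\<in>I. u a * (log_tangent ?p \<sigma> \<tau> a / ?p a)) =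
        total_weight u * \<sigma> + (\<Sum>i=1..<d. \<tau> i * moment u i)" .
    have "(\<Sum>a\<in>I. log_tangent ?p \<sigma> \<tau> a) =
        (\<Sum>a\<in>I. ?p a * \<sigma> + (\<Sum>i=1..<d. \<tau> i * (of_nat (a i) * ?p a)))"
      by (intro sum.cong) (auto simp: log_tangent_def sum_distrib_left algebra_simps)
    also have "\<dots> = (\<Sum>a\<in>I. ?p a) * \<sigma> + (\<Sum>i=1..<d. \<tau> i * (\<Sum>a\<in>I. of_nat (a i) * ?p a))"
      by (simp add: sum.distrib sum_distrib_left sum_distrib_right sum.swap[of _ I])
    also have "\<dots> = (\<Sum>a\<in>I. ?p a) * \<sigma> +
        (\<Sum>i=1..<d. \<tau> i * ((\<Sum>a\<in>I. ?p a) * (of_nat k * b i * y i / linear_form y)))"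
    proof -
      have "(\<Sum>a\<in>I. of_nat (a i) * ?p a) = (\<Sum>a\<in>I. ?p a) * (of_nat k * b i * y i / linear_form y)"
        if "i \<in> {1..<d}" for i
      proof -
        have "linear_form y ^ k = linear_form y ^ (k - 1) * linear_form y"
          using k by (metis One_nat_def Suc_pred le_simps(3) power_Suc2)
        then show ?thesis
          using L by (simp add: weighted_sum_monomial_point[OF that] sum_monomial_point mult_ac)
      qed
      then show ?thesis by simp
    qed
    also have "\<dots> = (\<Sum>a\<in>I. ?p a) * (\<sigma> + (\<Sum>i=1..<d. \<tau> i * (of_nat k * b i * y i / linear_form y)))"
      by (simp add: sum_distrib_left algebra_simps)
    finally have "(\<Sum>a\<in>I. log_tangent ?p \<sigma> \<tau> a) / (\<Sum>a\<in>I. ?p a) =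
        \<sigma> + (\<Sum>i=1..<d. \<tau> i * (of_nat k * b i * y i / linear_form y))"
      using sp by simp
    then have 2: "(\<Sum>a\<in>I. u a) * ((\<Sum>a\<in>I. log_tangent ?p \<sigma> \<tau> a) / (\<Sum>a\<in>I. ?p a)) =
        total_weight u * \<sigma> + (\<Sum>i=1..<d. \<tau> i * (of_nat k * total_weight u * b i * y i / linear_form y))"
      by (simp add: total_weight_def distrib_left sum_distrib_left mult_ac)
    show ?thesis
      unfolding 1 2 by (simp add: D_def right_diff_distrib sum_subtractf)
  qed
  have deriv: "((\<lambda>t. likelihood_branch I u ?p (?p + cscale t (log_tangent ?p \<sigma> \<tau>))) has_field_derivative
      (\<Sum>i=1..<d. \<tau> i * D i)) (at 0)" for \<sigma> \<tau>
    unfolding D[symmetric, of \<tau> \<sigma>]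
    by (rule has_field_derivative_likelihood_branch[OF finite_veronese_exponents p sp])
  have "?crit \<longleftrightarrow> (\<forall>\<sigma> \<tau>. ((\<lambda>t. likelihood_branch I u ?p (?p + cscale t (log_tangent ?p \<sigma> \<tau>))) has_field_derivative 0) (at 0))"
    unfolding tangent_space_eq[OF y] by auto
  also have "\<dots> \<longleftrightarrow> (\<forall>\<tau>. (\<Sum>i=1..<d. \<tau> i * D i) = 0)"
    using deriv DERIV_unique by metis
  also have "\<dots> \<longleftrightarrow> (\<forall>i\<in>{1..<d}. D i = 0)"
  proof (intro iffI ballI)
    fix i assume "\<forall>\<tau>. (\<Sum>i=1..<d. \<tau> i * D i) = 0" "i \<in> {1..<d}"
    from spec[OF this(1), of "\<lambda>j. if j = i then 1 else 0"] this(2) show "D i = 0"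
      by (simp add: if_distrib[of "\<lambda>x. x * _"] cong: if_cong)
  qed simp
  also have "\<dots> \<longleftrightarrow> ?eqs"
    using L by (auto simp: D_def field_simps)
  finally show ?thesis .
qed

text \<open>Adding up the likelihood equations determines the value of the linear form, and putting
  this value back into each equation gives \<open>y i\<close>. The entry at \<open>0\<close> is the
  scale, which is projectively irrelevant and normalized to \<open>1\<close>.\<close>

definition solution :: "((nat \<Rightarrow> nat) \<Rightarrow> complex) \<Rightarrow> nat \<Rightarrow> complex" where
  "solution u i = (if i = 0 then 1 else
     moment u i * b 0 / (b i * (of_nat k * total_weight u - (\<Sum>j=1..<d. moment u j))))"

text \<open>The first condition keeps the linear form nonzero at the solution, the second puts the
  solution into the torus, and the third makes the denominator in \<open>solution\<close>
  nonzero.\<close>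

definition nondegenerate :: "((nat \<Rightarrow> nat) \<Rightarrow> complex) \<Rightarrow> bool" where
  "nondegenerate u \<longleftrightarrow> total_weight u \<noteq> 0 \<and> (\<forall>i\<in>{1..<d}. moment u i \<noteq> 0) \<and>
     of_nat k * total_weight u \<noteq> (\<Sum>j=1..<d. moment u j)"

lemma linear_form_solution:
  assumes "nondegenerate u"
  shows "linear_form (solution u) =
    b 0 * of_nat k * total_weight u / (of_nat k * total_weight u - (\<Sum>j=1..<d. moment u j))"
proof -
  let ?E = "of_nat k * total_weight u - (\<Sum>j=1..<d. moment u j)"
  have E: "?E \<noteq> 0" using assms by (simp add: nondegenerate_def)
  have "(\<Sum>i=1..<d. b i * solution u i) = (\<Sum>i=1..<d. moment u i * (b 0 / ?E))"
    using linear_coefficient_nonzero by (intro sum.cong) (auto simp: solution_def)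
  also have "\<dots> = (\<Sum>i=1..<d. moment u i) * (b 0 / ?E)"
    by (simp only: sum_distrib_right)
  finally show ?thesis
    using E by (simp add: linear_form_def field_simps)
qed

lemma solution_in_torus: "nondegenerate u \<Longrightarrow> solution u \<in> torus"
  using linear_coefficient_nonzero constant_coefficient_nonzero
  by (auto simp: torus_def solution_def nondegenerate_def)

lemma likelihood_equations_iff:
  assumes u: "nondegenerate u" and L: "linear_form y \<noteq> 0"
  shows "(\<forall>i\<in>{1..<d}. moment u i * linear_form y = of_nat k * total_weight u * b i * y i)
     \<longleftrightarrow> (\<forall>i\<in>{1..<d}. y i = solution u i)"
proof
  let ?E = "of_nat k * total_weight u - (\<Sum>j=1..<d. moment u j)"
  have E: "?E \<noteq> 0" and ku: "of_nat k * total_weight u \<noteq> 0"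
    using u k by (auto simp: nondegenerate_def)
  {
    assume eqs: "\<forall>i\<in>{1..<d}. moment u i * linear_form y = of_nat k * total_weight u * b i * y i"
    \<comment> \<open>Each term \<open>b i * y i\<close> of the linear form is replaced by means of
      its own equation, which leaves one equation for the unknown
      \<open>linear_form y\<close>.\<close>
    have "of_nat k * total_weight u * linear_form y =
        of_nat k * total_weight u * b 0 + (\<Sum>i=1..<d. of_nat k * total_weight u * b i * y i)"
      by (simp add: linear_form_def distrib_left sum_distrib_left mult_ac)
    also have "(\<Sum>i=1..<d. of_nat k * total_weight u * b i * y i) = (\<Sum>i=1..<d. moment u i) * linear_form y"
      using eqs by (simp add: sum_distrib_right)
    finally have Ly: "linear_form y * ?E = of_nat k * total_weight u * b 0"
      by (simp add: algebra_simps)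
    show "\<forall>i\<in>{1..<d}. y i = solution u i"
    proof
      fix i assume i: "i \<in> {1..<d}"
      have "of_nat k * total_weight u * (y i * b i * ?E) = moment u i * (linear_form y * ?E)"
        using bspec[OF eqs i] by (simp add: mult_ac)
      also have "\<dots> = of_nat k * total_weight u * (moment u i * b 0)"
        unfolding Ly by (simp add: mult_ac)
      finally have "y i * (b i * ?E) = moment u i * b 0"
        using ku by (simp add: mult_ac)
      then show "y i = solution u i"
        using i E linear_coefficient_nonzero[OF i] by (simp add: solution_def nonzero_eq_divide_eq)
    qed
  }
  {
    assume eq: "\<forall>i\<in>{1..<d}. y i = solution u i"
    have "linear_form y = linear_form (solution u)"
      using eq by (simp add: linear_form_def)
    then have Ly: "linear_form y = b 0 * of_nat k * total_weight u / ?E"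
      by (simp add: linear_form_solution[OF u])
    show "\<forall>i\<in>{1..<d}. moment u i * linear_form y = of_nat k * total_weight u * b i * y i"
    proof
      fix i assume i: "i \<in> {1..<d}"
      then have "y i = moment u i * b 0 / (b i * ?E)"
        using eq by (simp add: solution_def)
      then show "moment u i * linear_form y = of_nat k * total_weight u * b i * y i"
        unfolding Ly using linear_coefficient_nonzero[OF i] by simp
    qed
  }
qed

text \<open>Off the hyperplanes a point has torus coordinates and a nonzero linear form, so the
  equations apply and fix all coordinates but the scale. The remaining freedom is exactly the choice
  of a representative of one projective point.\<close>

lemma likelihood_critical_points_eq:
  assumes u: "nondegenerate u"
  shows "likelihood_critical_points I X u = {proj_point (monomial_point (solution u))}"
proof (intro equalityI subsetI)
  fix x assume x: "x \<in> likelihood_critical_points I X u"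
  then have "x \<in> X" and not_H: "x \<notin> likelihood_hyperplanes I"
    by (auto simp: likelihood_critical_points_def smooth_points_def)
  then obtain p where p: "x = proj_point p" "p \<in> zariski_closure I (monomial_point ` torus)"
    by (auto simp: scaled_veronese_def scaled_veronese_torus_eq)
  have px: "p \<in> x" by (simp add: p proj_point_self)
  have "x \<in> proj_space I"
    using \<open>x \<in> X\<close> scaled_veronese_subset by blast
  then have nz: "\<forall>a\<in>I. p a \<noteq> 0" and sum: "(\<Sum>a\<in>I. p a) \<noteq> 0"
    using not_H px by (auto simp: likelihood_hyperplanes_def)
  obtain y where y: "y \<in> torus" "p = monomial_point y"
    using nonzero_point_in_torus[OF p(2)] nz by blast
  have L: "linear_form y \<noteq> 0"
    using sum k unfolding y(2) sum_monomial_point by auto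
  have "\<forall>v\<in>cone_tangent_space I X (monomial_point y).
       ((\<lambda>t. likelihood_branch I u (monomial_point y) (monomial_point y + cscale t v)) has_field_derivative 0) (at 0)"
    using x px unfolding likelihood_critical_points_def y(2) by blast
  then have eq: "\<forall>i\<in>{1..<d}. y i = solution u i"
    unfolding likelihood_equations[OF y(1) L] likelihood_equations_iff[OF u L] .
  have "monomial_point y = monomial_point ((solution u)(0 := y 0 * solution u 0))"
    by (rule monomial_point_cong) (use eq in \<open>auto simp: solution_def\<close>)
  then have "p = cscale (y 0) (monomial_point (solution u))"
    by (simp add: y(2) cscale_monomial_point)
  moreover have "y 0 \<noteq> 0"
    using y(1) d by (auto simp: torus_def)
  ultimately show "x \<in> {proj_point (monomial_point (solution u))}"
    by (simp add: p(1) proj_point_cscale)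
next
  let ?x = "proj_point (monomial_point (solution u))"
  fix x assume "x \<in> {?x}"
  then have x: "x = ?x" by simp
  have L: "linear_form (solution u) \<noteq> 0"
    unfolding linear_form_solution[OF u] using u k constant_coefficient_nonzero
    by (simp add: nondegenerate_def)
  \<comment> \<open>Criticality and avoidance of the hyperplanes must be checked at every
    representative; rescaling changes only \<open>y 0\<close>, which neither the linear form nor the
    equations involve.\<close>
  have rep: "\<exists>y\<in>torus. p = monomial_point y \<and> (\<forall>i\<in>{1..<d}. y i = solution u i) \<and> linear_form y \<noteq> 0"
    if "p \<in> ?x" for p
  proof -
    obtain t where t: "t \<noteq> 0" "p = cscale t (monomial_point (solution u))"
      using \<open>p \<in> ?x\<close> by (auto simp: proj_point_def)
    let ?y = "(solution u)(0 := t * solution u 0)"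
    have "linear_form ?y = linear_form (solution u)"
      by (simp add: linear_form_def)
    moreover have "?y \<in> torus"
      using solution_in_torus[OF u] t d by (auto simp: torus_def)
    ultimately show ?thesis
      using L unfolding t cscale_monomial_point by (intro bexI[of _ ?y]) auto
  qed
  have "?x \<notin> likelihood_hyperplanes I"
  proof
    assume "?x \<in> likelihood_hyperplanes I"
    then obtain p where p: "p \<in> ?x" "(\<exists>a\<in>I. p a = 0) \<or> (\<Sum>a\<in>I. p a) = 0"
      by (auto simp: likelihood_hyperplanes_def)
    obtain y where "y \<in> torus" "p = monomial_point y" "linear_form y \<noteq> 0"
      using rep[OF p(1)] by blast
    then show False
      using p(2) monomial_point_nonzero[of y] d by (auto simp: sum_monomial_point torus_def)
  qed
  moreover have "((\<lambda>t. likelihood_branch I u p (p + cscale t v)) has_field_derivative 0) (at 0)"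
    if p: "p \<in> ?x" and v: "v \<in> cone_tangent_space I X p" for p v
  proof -
    obtain y where y: "y \<in> torus" "p = monomial_point y" "\<forall>i\<in>{1..<d}. y i = solution u i" "linear_form y \<noteq> 0"
      using rep[OF p] by blast
    then show ?thesis
      using v likelihood_equations[OF y(1,4), of u] likelihood_equations_iff[OF u y(4)] by simp
  qed
  ultimately show "x \<in> likelihood_critical_points I X u"
    unfolding x likelihood_critical_points_def
    using torus_point_smooth[OF solution_in_torus[OF u]] by blast
qed

lemma generically_nondegenerate: "generically I nondegenerate"
proof -
  define H where "H u = total_weight u * (\<Prod>i=1..<d. moment u i) *
      (of_nat k * total_weight u - (\<Sum>j=1..<d. moment u j))" for u
  have H_iff: "nondegenerate u \<longleftrightarrow> H u \<noteq> 0" for u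
    by (auto simp: H_def nondegenerate_def)
  have moment_poly: "(\<lambda>u. moment u i) \<in> poly_funs I" for i
    unfolding moment_def
    by (intro poly_funs_sum poly_funs_mult poly_funs_coord poly_funs_const finite_veronese_exponents)
  have total_poly: "total_weight \<in> poly_funs I"
    unfolding total_weight_def[abs_def] by (intro poly_funs_sum poly_funs_coord finite_veronese_exponents)
  have H: "H \<in> poly_funs I"
    unfolding H_def[abs_def]
    by (intro poly_funs_mult poly_funs_diff poly_funs_sum poly_funs_prod poly_funs_const
        total_poly moment_poly)
  \<comment> \<open>All weights equal to \<open>1\<close> show that the conditions can be met: the
    moments are positive integers, and they add up to less than \<open>k * card I\<close> because
    each exponent has degree at most \<open>k\<close> and the zero exponent has degree below
    \<open>k\<close>.\<close>
  define w :: "(nat \<Rightarrow> nat) \<Rightarrow> complex" where "w a = (if a \<in> I then 1 else 0)" for a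
  have total_w: "total_weight w = of_nat (card I)"
    by (simp add: total_weight_def w_def)
  have moment_w: "moment w i = of_nat (\<Sum>a\<in>I. a i)" for i
    by (simp add: moment_def w_def)
  have "total_weight w \<noteq> 0"
    using finite_veronese_exponents[of d k] zero_in_veronese_exponents[of d k]
    unfolding total_w by (metis card_0_eq empty_iff of_nat_eq_0_iff)
  moreover have "moment w i \<noteq> 0" if i: "i \<in> {1..<d}" for i
  proof -
    have "unit_exponent i i \<le> (\<Sum>a\<in>I. a i)"
      using unit_in_veronese_exponents[OF i k] finite_veronese_exponents[of d k]
      by (intro member_le_sum[of "unit_exponent i" I "\<lambda>a. a i"]) auto
    then have "(\<Sum>a\<in>I. a i) \<noteq> 0"
      by (simp add: unit_exponent_def)
    then show ?thesis
      unfolding moment_w of_nat_eq_0_iff .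
  qed
  moreover have "of_nat k * total_weight w \<noteq> (\<Sum>j=1..<d. moment w j)"
  proof -
    have "(\<Sum>j=1..<d. \<Sum>a\<in>I. a j) = (\<Sum>a\<in>I. \<Sum>j=1..<d. a j)"
      by (rule sum.swap)
    also have "\<dots> < (\<Sum>a\<in>I. k)"
      using k finite_veronese_exponents zero_in_veronese_exponents
      by (intro sum_strict_mono_ex1) (auto simp: veronese_exponents_def intro!: bexI[of _ "\<lambda>_. 0"])
    finally have "(\<Sum>j=1..<d. \<Sum>a\<in>I. a j) < k * card I"
      by (simp only: sum_constant mult.commute of_nat_id)
    then have "k * card I \<noteq> (\<Sum>j=1..<d. \<Sum>a\<in>I. a j)"
      by (rule less_imp_neq[symmetric])
    then have "(of_nat (k * card I) :: complex) \<noteq> of_nat (\<Sum>j=1..<d. \<Sum>a\<in>I. a j)"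
      by (simp only: of_nat_eq_iff not_False_eq_True)
    then show ?thesis
      by (simp add: total_w moment_w)
  qed
  ultimately have "nondegenerate w"
    unfolding nondegenerate_def by blast
  then have "H w \<noteq> 0"
    by (simp add: H_iff)
  moreover have "w \<in> affine_space I"
    by (simp add: w_def affine_space_def)
  ultimately have "{u \<in> affine_space I. H u = 0} \<noteq> affine_space I"
    by blast
  moreover have "zariski_closed I {u \<in> affine_space I. H u = 0}"
    unfolding zariski_closed_def using H by (intro exI[of _ "{H}"]) auto
  ultimately show ?thesis
    unfolding generically_def using H_iff by (intro exI[of _ "{u \<in> affine_space I. H u = 0}"]) auto
qed

theorem mldeg_eq_1: "mldeg I X = 1"
proof (rule mldeg_eqI[OF finite_veronese_exponents])
  obtain Z where "zariski_closed I Z" "Z \<noteq> affine_space I" "\<forall>u\<in>affine_space I - Z. nondegenerate u"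
    using generically_nondegenerate unfolding generically_def by blast
  then show "generically I (\<lambda>u. finite (likelihood_critical_points I X u) \<and>
      card (likelihood_critical_points I X u) = 1)"
    unfolding generically_def
    by (intro exI[of _ Z]) (simp add: likelihood_critical_points_eq)
qed

end

theorem theorem25:
  fixes d k :: nat
    and c :: "(nat \<Rightarrow> nat) \<Rightarrow> complex"
    and T :: "nat list \<Rightarrow> complex"
  assumes "d \<ge> 2" and "k \<ge> 1"
    and "\<And>a. a \<in> veronese_exponents d k \<Longrightarrow> c a \<noteq> 0"
    and "symmetric_tensor d k T"
    and "\<And>\<theta>. tensor_poly d k T \<theta> = scaling_poly d k c \<theta>"
    and "tensor_rank_one d k T"
  shows "mldeg (veronese_exponents d k) (scaled_veronese d k c) = 1"
proof -
  obtain b where "\<And>\<theta>. tensor_poly d k T \<theta> = (b 0 + (\<Sum>i=1..<d. b i * \<theta> i)) ^ k"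
    using assms(6) by (auto simp: tensor_rank_one_def)
  then interpret power_of_linear_form d k c b
    using assms by unfold_locales auto
  show ?thesis
    by (rule mldeg_eq_1)
qed

end
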